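(* There exists $d_*>0$ such that for all $0<d<d_*$ there exists a smooth curve $\Gamma(d)\subset\ell^\infty\times(0,1)$ satisfying the following: (1) For each fixed $d\in(0,d_* )$ every element $(U,\mu)\in\Gamma(d)$ satisfies $$0=d(U_{n+1}+U_{n-1}-2U_n)+U_n(U_n-\mu)(1-U_n),\qquad n\in\mathbb Z,$$ for the given value of $d>0$, and $U=\{U_n\}_{n\in\mathbb Z}$ is such that $U_n\to0$ as $n\to-\infty$ and $U_n\to1$ as $n\to\infty$. (2) $\pi(\Gamma(d))$ is a closed loop for all $d\in(0,d_* )$. (3) $\Gamma(d)\to\Gamma_0$ uniformly in the $\ell^\infty\times\mathbb R$ norm as $d\to0^+$.
   Context: $\ell^\infty$ is the Banach space of bounded real sequences $U=\{U_n\}_{n\in\mathbb Z}$ with norm $\|U\|_\infty=\sup_n|U_n|$. The shift $S:\ell^\infty\to\ell^\infty$ is $[SU]_n=U_{n+1}$. $\ell^\infty/\langle S\rangle$ is the set of equivalence classes $[U]$ under $U\sim V$ iff $S^pU=V$ for some $p\in\mathbb Z$, and $\pi(U,\mu)=([U],\mu)$. A set $\pi(\Gamma)$ is a closed loop if it can be parameterized by a smooth map $\gamma:[0,1]\to\pi(\Gamma)$, $s\mapsto([U](s),\mu(s))$, with $\gamma(0)=\gamma(1)$. For $\mu\in[0,1]$ define $\bar U(\mu),\bar V(\mu)\in\ell^\infty$ by $\bar U_n(\mu)=0$ for $n\le0$, $\bar U_n(\mu)=1$ for $n>0$; and $\bar V_n(\mu)=0$ for $n<0$, $\bar V_0(\mu)=\mu$,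 $\bar V_n(\mu)=1$ for $n>0$. Set $$\Gamma_0:=\bigcup_{p\in\mathbb Z}\bigcup_{\mu\in[0,1]}\{(S^p\bar U(\mu),\mu),(S^p\bar V(\mu),\mu)\}\subset\ell^\infty\times[0,1].$$ Uniform convergence of the curves $\Gamma(d)$ to $\Gamma_0$ is convergence as subsets of $\ell^\infty\times\mathbb R$, i.e. in Hausdorff distance. *)

theory Defs
  imports "HOL-Analysis.Analysis"
begin

section \<open>The sequence space and the shift\<close>

text \<open>The type \<^typ>\<open>int\<close> carries the discrete topology, so the bounded continuous functions
  \<^typ>\<open>int \<Rightarrow>\<^sub>C real\<close> are exactly the bounded bi-infinite real sequences, and the library's norm
  on this type is the supremum norm.\<close>

unbundle bcontfun.lifting

type_synonym linf = "int \<Rightarrow>\<^sub>C real"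

text \<open>\<open>shift p\<close> is the integer power \<open>S\<^sup>p\<close> of the shift \<open>[S U]\<^sub>n = U\<^sub>n\<^sub>+\<^sub>1\<close>.\<close>

lift_definition shift :: "int \<Rightarrow> linf \<Rightarrow> linf" is "\<lambda>p U n. U (n + p)"
  by (auto simp: bcontfun_def intro: bounded_subset)

lemma apply_shift [simp]: "apply_bcontfun (shift p U) n = apply_bcontfun U (n + p)"
  by transfer simp

lemma shift_0 [simp]: "shift 0 U = U"
  by (rule bcontfun_eqI) simp

lemma shift_add: "shift (p + q) U = shift p (shift q U)"
  by (rule bcontfun_eqI) (simp add: algebra_simps)

definition shift_rel :: "(linf \<times> linf) set" where
  "shift_rel = {(U, V). \<exists>p. shift p U = V}"

lemma equiv_shift_rel: "equiv UNIV shift_rel"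
proof (rule equivI)
  show "refl shift_rel"
    by (auto simp: refl_on_def shift_rel_def intro: exI [of _ 0])
  show "sym shift_rel"
  proof (rule symI)
    fix U V assume "(U, V) \<in> shift_rel"
    then obtain p where "shift p U = V" by (auto simp: shift_rel_def)
    then have "shift (- p) V = U" by (auto simp flip: shift_add)
    then show "(V, U) \<in> shift_rel" by (auto simp: shift_rel_def)
  qed
  show "trans shift_rel"
    by (auto simp: trans_def shift_rel_def simp flip: shift_add)
qed simp

text \<open>The map \<open>\<pi>(U, \<mu>) = ([U], \<mu>)\<close>; equivalence classes are elements of
  \<^term>\<open>UNIV // shift_rel\<close>.\<close>

definition shift_proj :: "linf \<times> real \<Rightarrow> linf set \<times> real" where
  "shift_proj = (\<lambda>(U, \<mu>). (shift_rel `` {U}, \<mu>))"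

section \<open>Smooth curves and closed loops\<close>

text \<open>\<open>C\<^sup>\<infinity>\<close> on \<open>I\<close>: \<open>D k\<close> is the \<open>k\<close>-th derivative, one-sided at endpoints of \<open>I\<close>.
  Only used for sets \<open>I\<close> without isolated points.\<close>

definition smooth_on :: "real set \<Rightarrow> (real \<Rightarrow> 'a::real_normed_vector) \<Rightarrow> bool" where
  "smooth_on I g \<longleftrightarrow>
    (\<exists>D. (\<forall>t\<in>I. D 0 t = g t) \<and>
         (\<forall>k. \<forall>t\<in>I. (D k has_vector_derivative D (Suc k) t) (at t within I)))"

text \<open>A smooth curve is a (nonempty) connected, one-dimensional, embedded \<open>C\<^sup>\<infinity>\<close> submanifold
  without boundary.\<close>

definition smooth_curve :: "'a::real_normed_vector set \<Rightarrow> bool" where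
  "smooth_curve \<Gamma> \<longleftrightarrow> \<Gamma> \<noteq> {} \<and> connected \<Gamma> \<and>
    (\<forall>x\<in>\<Gamma>. \<exists>W g h. open W \<and> x \<in> W \<and> smooth_on UNIV g \<and>
       (\<forall>t. vector_derivative g (at t) \<noteq> 0) \<and> homeomorphism UNIV (\<Gamma> \<inter> W) g h)"

text \<open>A map into the quotient by the (discrete) shift action is smooth if it lifts locally to a
  smooth map into \<open>\<ell>\<^sup>\<infinity> \<times> \<real>\<close>.\<close>

definition smooth_mod_shift :: "real set \<Rightarrow> (real \<Rightarrow> linf set \<times> real) \<Rightarrow> bool" where
  "smooth_mod_shift I \<gamma> \<longleftrightarrow>
    (\<forall>s\<in>I. \<exists>e>0. \<exists>g. smooth_on (I \<inter> ball s e) g \<and>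
       (\<forall>t\<in>I \<inter> ball s e. \<gamma> t = shift_proj (g t)))"

text \<open>A parameterization of a loop is one-to-one apart from the identification of its
  endpoints; this excludes an arc traversed back and forth.\<close>

definition closed_loop :: "(linf set \<times> real) set \<Rightarrow> bool" where
  "closed_loop L \<longleftrightarrow>
    (\<exists>\<gamma>. smooth_mod_shift {0..1} \<gamma> \<and> \<gamma> ` {0..1} = L \<and> inj_on \<gamma> {0..<1} \<and> \<gamma> 0 = \<gamma> 1)"

section \<open>Hausdorff distance\<close>

text \<open>Extended-valued, because neither set need be bounded.  The library's norm on
  \<open>\<ell>\<^sup>\<infinity> \<times> \<real>\<close> is \<open>sqrt (\<parallel>U\<parallel>\<^sup>2 + \<mu>\<^sup>2)\<close>, which is equivalent to the maximum norm, so
  convergence in this distance does not depend on the choice.\<close>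

definition hausdorff_dist :: "'a::metric_space set \<Rightarrow> 'a set \<Rightarrow> ennreal" where
  "hausdorff_dist A B =
    max (SUP x\<in>A. INF y\<in>B. ennreal (dist x y)) (SUP y\<in>B. INF x\<in>A. ennreal (dist x y))"

section \<open>The discrete Nagumo equation and its limit curve\<close>

definition nagumo_steady :: "real \<Rightarrow> linf \<Rightarrow> real \<Rightarrow> bool" where
  "nagumo_steady d U \<mu> \<longleftrightarrow>
    (\<forall>n. 0 = d * (U (n + 1) + U (n - 1) - 2 * U n) + U n * (U n - \<mu>) * (1 - U n))"

lift_definition Ubar :: "real \<Rightarrow> linf" is "\<lambda>\<mu> n. if n \<le> 0 then 0 else 1"
proof -
  have "range (\<lambda>n::int. if n \<le> 0 then 0 else 1 :: real) \<subseteq> {0, 1}" by auto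
  then show "(\<lambda>n::int. if n \<le> 0 then 0 else 1 :: real) \<in> bcontfun"
    by (auto simp: bcontfun_def intro: bounded_subset)
qed

lift_definition Vbar :: "real \<Rightarrow> linf" is "\<lambda>\<mu> n. if n < 0 then 0 else if n = 0 then \<mu> else 1"
proof -
  fix \<mu> :: real
  have "range (\<lambda>n::int. if n < 0 then 0 else if n = 0 then \<mu> else 1) \<subseteq> {0, \<mu>, 1}" by auto
  then show "(\<lambda>n::int. if n < 0 then 0 else if n = 0 then \<mu> else 1) \<in> bcontfun"
    by (auto simp: bcontfun_def intro: bounded_subset)
qed

definition Gamma0 :: "(linf \<times> real) set" where
  "Gamma0 = (\<Union>p. \<Union>\<mu>\<in>{0..1}. {(shift p (Ubar \<mu>), \<mu>), (shift p (Vbar \<mu>), \<mu>)})"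

end

(* Near the singular limit a front is determined by s = U_0.  Solving the equation at site 0
   for mu and the equation at every other site n for the deviation of U_n from its limit state
   turns the problem into a fixed point equation for the deviations, which is a contraction on the
   ball of radius 12 d, with factor 1/2, uniformly for s between 3d/2 and 1 - 3d/2.  The fixed
   point equation makes sense for complex s, so the iterates are holomorphic in s and converge
   uniformly; Cauchy estimates, uniform in n, then make s |-> U smooth into l^infinity without an
   implicit function theorem in Banach spaces.

   Uniqueness of the fixed point glues the arc of fronts to its own translates: if s is of order d,
   then the shifted front is again a front, with parameter U_1.  Following s from 2d to the
   parameter of the shifted front runs through the loop modulo shifts exactly once. *)

theory Submission
  imports Defs "HOL-Complex_Analysis.Complex_Analysis"
begin

section \<open>Smooth sequence-valued maps from holomorphic coordinates\<close>

text \<open>The curve cannot be parameterized by \<mu>: to leading order \<mu> = s + d/s - d/(1-s),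
  which folds near s = sqrt d and s = 1 - sqrt d. At the folds \<mu>, respectively 1 - \<mu>, is
  only about 2 sqrt d, while the coupling d gets divided by \<mu> at the sites left of 0 and by 1 -
  \<mu> at those right of 0. The contraction therefore needs both quantities to be much larger than
  d; for \<open>d < 1 / 10 ^ 6\<close> the fold value 2 sqrt d exceeds 2000 d. As s decreases to
  order d, \<mu> climbs back like d/s and is near 1/2 at s = 2d. The shift of that front has U_0
  about 1 - 2d, which is where consecutive translates are joined; the margin 3d/2 leaves an overlap
  around this point. The asymptotic estimates are too coarse to order the values of U_1 close to the
  junction. Uniqueness of the fixed point makes s |-> U_1 injective there, hence monotone.\<close>

lemma apply_Bcontfun_bounded:
  fixes f :: "int \<Rightarrow> real"
  assumes "\<And>n. \<bar>f n\<bar> \<le> B"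
  shows "apply_bcontfun (Bcontfun f) = f"
proof -
  have "f \<in> bcontfun"
    using assms by (auto simp: bcontfun_def bounded_iff)
  then show ?thesis by (simp add: Bcontfun_inverse)
qed

lemma norm_linf_le:
  fixes U :: linf
  assumes "\<And>n. \<bar>U n\<bar> \<le> B"
  shows "norm U \<le> B"
proof -
  have "dist U 0 \<le> B"
    by (rule dist_bound) (use assms in \<open>simp add: dist_norm\<close>)
  then show ?thesis by simp
qed

lemma abs_apply_le_norm:
  fixes U :: linf
  shows "\<bar>U n\<bar> \<le> norm U"
  using norm_bounded [of U n] by simp

lemma dist_shift [simp]: "dist (shift p U) (shift p V) = dist U V"
proof (rule antisym)
  show "dist (shift p U) (shift p V) \<le> dist U V"
    by (rule dist_bound) (simp add: dist_bounded)
  show "dist U V \<le> dist (shift p U) (shift p V)"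
  proof (rule dist_bound)
    fix n show "dist (U n) (V n) \<le> dist (shift p U) (shift p V)"
      using dist_bounded [of "shift p U" "n - p" "shift p V"] by simp
  qed
qed

lemma bounded_linear_shift: "bounded_linear (shift p)"
proof (rule bounded_linear_intro [where K = 1])
  fix U V :: linf and r :: real
  show "shift p (U + V) = shift p U + shift p V"
    by (rule bcontfun_eqI) simp
  show "shift p (r *\<^sub>R U) = r *\<^sub>R shift p U"
    by (rule bcontfun_eqI) simp
  show "norm (shift p U) \<le> norm U * 1"
    by (rule norm_linf_le) (simp add: abs_apply_le_norm)
qed

lemma bounded_linear_apply: "bounded_linear (\<lambda>U :: linf. U n)"
  by (rule bounded_linear_intro [where K = 1]) (auto simp: abs_apply_le_norm)

lemma smooth_on_bounded_linear:
  assumes "bounded_linear L" "smooth_on I g"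
  shows "smooth_on I (\<lambda>t. L (g t))"
proof -
  obtain D where D: "\<forall>t\<in>I. D 0 t = g t"
      "\<forall>k. \<forall>t\<in>I. (D k has_vector_derivative D (Suc k) t) (at t within I)"
    using assms(2) by (auto simp: smooth_on_def)
  show ?thesis unfolding smooth_on_def
    by (rule exI [of _ "\<lambda>k t. L (D k t)"])
      (use D in \<open>auto intro: bounded_linear.has_vector_derivative [OF assms(1)]\<close>)
qed

lemma smooth_on_Pair:
  assumes "smooth_on I f" "smooth_on I g"
  shows "smooth_on I (\<lambda>t. (f t, g t))"
proof -
  obtain D where D: "\<forall>t\<in>I. D 0 t = f t"
      "\<forall>k. \<forall>t\<in>I. (D k has_vector_derivative D (Suc k) t) (at t within I)"
    using assms(1) by (auto simp: smooth_on_def)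
  obtain E where E: "\<forall>t\<in>I. E 0 t = g t"
      "\<forall>k. \<forall>t\<in>I. (E k has_vector_derivative E (Suc k) t) (at t within I)"
    using assms(2) by (auto simp: smooth_on_def)
  show ?thesis unfolding smooth_on_def
    by (rule exI [of _ "\<lambda>k t. (D k t, E k t)"])
      (use D E in \<open>auto intro!: has_vector_derivative_Pair\<close>)
qed

lemma smooth_on_imp_continuous_on:
  assumes "smooth_on I g"
  shows "continuous_on I g"
proof -
  obtain D where D: "\<forall>t\<in>I. D 0 t = g t"
      "\<forall>k. \<forall>t\<in>I. (D k has_vector_derivative D (Suc k) t) (at t within I)"
    using assms by (auto simp: smooth_on_def)
  from D(2) have "continuous_on I (D 0)"
    by (auto simp: continuous_on_eq_continuous_within intro: has_vector_derivative_continuous)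
  then show ?thesis
    using D(1) by (simp cong: continuous_on_cong)
qed

lemma smooth_on_subset:
  assumes "smooth_on I g" "J \<subseteq> I"
  shows "smooth_on J g"
proof -
  obtain D where D: "\<forall>t\<in>I. D 0 t = g t"
      "\<forall>k. \<forall>t\<in>I. (D k has_vector_derivative D (Suc k) t) (at t within I)"
    using assms(1) by (auto simp: smooth_on_def)
  show ?thesis unfolding smooth_on_def
  proof (intro exI [of _ D] conjI ballI allI)
    fix k t assume "t \<in> J"
    then show "(D k has_vector_derivative D (Suc k) t) (at t within J)"
      using D(2) assms(2) by (intro has_vector_derivative_within_subset [of _ _ t I J]) auto
  qed (use D(1) assms(2) in auto)
qed

lemma smooth_on_UNIV_imp_differentiable:
  assumes "smooth_on UNIV g"
  shows "g differentiable (at t)"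
proof -
  obtain D where D: "\<forall>t. D 0 t = g t"
      "\<forall>k. \<forall>t. (D k has_vector_derivative D (Suc k) t) (at t)"
    using assms by (auto simp: smooth_on_def)
  then have "D 0 = g" by auto
  then show ?thesis
    using D(2) differentiableI_vector by metis
qed

text \<open>Local bounds that are uniform in the index are what turns coordinatewise derivatives into
  derivatives with respect to the supremum norm.\<close>

definition holo_family :: "complex set \<Rightarrow> (int \<Rightarrow> complex \<Rightarrow> complex) \<Rightarrow> bool" where
  "holo_family N y \<longleftrightarrow> open N \<and> (\<forall>n. y n holomorphic_on N) \<and>
     (\<forall>z\<in>N. \<exists>r>0. \<exists>B. ball z r \<subseteq> N \<and> (\<forall>n. \<forall>w\<in>ball z r. norm (y n w) \<le> B))"

text \<open>\<open>Bcontfun\<close> returns the intended sequence only for bounded coordinates,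
  which \<open>holo_family\<close> guarantees. Taking \<open>Re\<close> gives a real sequence
  without first proving the coordinates real.\<close>

definition trace :: "(int \<Rightarrow> complex \<Rightarrow> complex) \<Rightarrow> real \<Rightarrow> linf" where
  "trace y t = Bcontfun (\<lambda>n. Re (y n (of_real t)))"

lemma holo_family_bounded:
  assumes "holo_family N y" "z \<in> N"
  obtains B where "\<And>n. norm (y n z) \<le> B"
  using assms unfolding holo_family_def by (meson centre_in_ball)

lemma trace_apply:
  assumes "holo_family N y" "of_real t \<in> N"
  shows "trace y t n = Re (y n (of_real t))"
proof -
  obtain B where "\<And>n. norm (y n (of_real t)) \<le> B"
    using holo_family_bounded [OF assms] by blast
  then have "\<bar>Re (y n (of_real t))\<bar> \<le> B" for n
    using abs_Re_le_cmod order_trans by blast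
  then show ?thesis
    unfolding trace_def by (subst apply_Bcontfun_bounded) auto
qed

text \<open>Cauchy's inequality on discs of the fixed radius r/4 turns the bound B, common to all n,
  into a common bound for the derivatives. The notion is thus closed under differentiation, and
  every order of smoothness follows by iteration.\<close>

lemma holo_family_deriv:
  assumes "holo_family N y"
  shows "holo_family N (\<lambda>n. deriv (y n))"
  unfolding holo_family_def
proof (intro conjI allI ballI)
  show N: "open N" using assms by (simp add: holo_family_def)
  show "deriv (y n) holomorphic_on N" for n
    using assms N by (intro holomorphic_deriv) (auto simp: holo_family_def)
  fix z assume "z \<in> N"
  then obtain r B where r: "r > 0" "ball z r \<subseteq> N"
      and B: "\<And>n w. w \<in> ball z r \<Longrightarrow> norm (y n w) \<le> B"
    using assms unfolding holo_family_def by meson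
  have "norm (deriv (y n) w) \<le> B / (r / 4)" if w: "w \<in> ball z (r / 2)" for n w
  proof -
    have sub: "cball w (r / 4) \<subseteq> ball z r"
    proof
      fix v assume "v \<in> cball w (r / 4)"
      then show "v \<in> ball z r"
        using w dist_triangle [of z v w] r(1) by (auto simp: dist_commute)
    qed
    have hol: "y n holomorphic_on cball w (r / 4)"
      using assms sub r(2) by (auto simp: holo_family_def intro: holomorphic_on_subset)
    have "norm ((deriv ^^ 1) (y n) w) \<le> fact 1 * B / (r / 4) ^ 1"
    proof (rule Cauchy_inequality)
      show "y n holomorphic_on ball w (r / 4)"
        using hol ball_subset_cball holomorphic_on_subset by blast
      show "continuous_on (cball w (r / 4)) (y n)"
        using hol by (rule holomorphic_on_imp_continuous_on)
      show "0 < r / 4" using r by simp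
      fix v assume "norm (w - v) = r / 4"
      then have "v \<in> ball z r" using sub by (auto simp: dist_norm subset_iff)
      then show "norm (y n v) \<le> B" by (rule B)
    qed
    then show ?thesis by simp
  qed
  moreover have "ball z (r / 2) \<subseteq> N"
    using r subset_ball [of "r / 2" r z] by auto
  ultimately show "\<exists>r>0. \<exists>B. ball z r \<subseteq> N \<and> (\<forall>n. \<forall>w\<in>ball z r. norm (deriv (y n) w) \<le> B)"
    using r(1) by (intro exI [of _ "r / 2"] conjI exI [of _ "B / (r / 4)"]) auto
qed

lemma holo_family_iterated_deriv:
  assumes "holo_family N y"
  shows "holo_family N (\<lambda>n. (deriv ^^ k) (y n))"
  by (induction k) (use assms holo_family_deriv in auto)

text \<open>The Taylor remainder is at most C h^2 with one C for all n, so the difference quotients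
  converge in the supremum norm and not only coordinate by coordinate.\<close>

lemma has_vector_derivative_trace:
  assumes y: "holo_family N y" and t: "of_real t \<in> N"
  shows "(trace y has_vector_derivative trace (\<lambda>n. deriv (y n)) t) (at t)"
proof -
  let ?y' = "\<lambda>n. deriv (y n)" and ?y'' = "\<lambda>n. deriv (deriv (y n))"
  have y': "holo_family N ?y'" and y'': "holo_family N ?y''"
    using y holo_family_deriv by blast+
  obtain r C where r: "r > 0" "ball (of_real t) r \<subseteq> N"
      and C: "\<And>n w. w \<in> ball (of_real t) r \<Longrightarrow> norm (?y'' n w) \<le> C"
    using y'' t unfolding holo_family_def by meson
  have est: "norm (trace y (t + h) - trace y t - h *\<^sub>R trace ?y' t) \<le> C * \<bar>h\<bar>\<^sup>2"
    if h: "\<bar>h\<bar> < r" for h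
  proof (rule norm_linf_le)
    fix n
    let ?t = "complex_of_real t" and ?th = "complex_of_real (t + h)"
    have th: "?th \<in> ball ?t r"
      using h by (simp add: dist_norm)
    \<comment> \<open>\<open>complex_Taylor\<close> expects the derivatives indexed by their order;
      only orders 0, 1 and 2 occur.\<close>
    define f where "f i = (if i = 0 then y n else if i = 1 then ?y' n else ?y'' n)" for i :: nat
    have "cmod (f 0 ?th - (\<Sum>i\<le>1. f i ?t * (?th - ?t) ^ i / fact i))
            \<le> C * cmod (?th - ?t) ^ Suc 1 / fact 1"
    proof (rule complex_Taylor [of "ball ?t r"])
      fix i x assume i: "x \<in> ball ?t r" "(i::nat) \<le> 1"
      have "f i holomorphic_on N"
        using y y' i by (auto simp: holo_family_def f_def)
      then have "(f i has_field_derivative deriv (f i) x) (at x)"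
        using y i r by (auto simp: holo_family_def intro: holomorphic_derivI)
      moreover have "deriv (f i) = f (Suc i)"
        using i by (cases "i = 0") (auto simp: f_def)
      ultimately show "(f i has_field_derivative f (Suc i) x) (at x within ball ?t r)"
        by (auto intro: has_field_derivative_at_within)
    qed (use C th r in \<open>auto simp: f_def\<close>)
    then have "cmod (y n ?th - y n ?t - of_real h * ?y' n ?t) \<le> C * \<bar>h\<bar>\<^sup>2"
      by (simp add: f_def algebra_simps power2_eq_square)
    moreover have "\<bar>Re (y n ?th - y n ?t - of_real h * ?y' n ?t)\<bar> \<le> cmod (y n ?th - y n ?t - of_real h * ?y' n ?t)"
      by (rule abs_Re_le_cmod)
    moreover have "(trace y (t + h) - trace y t - h *\<^sub>R trace ?y' t) n
        = Re (y n ?th - y n ?t - of_real h * ?y' n ?t)"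
      using th r t by (simp add: trace_apply [OF y] trace_apply [OF y'] subset_iff)
    ultimately show "\<bar>(trace y (t + h) - trace y t - h *\<^sub>R trace ?y' t) n\<bar> \<le> C * \<bar>h\<bar>\<^sup>2"
      by linarith
  qed
  have "((\<lambda>h. norm (trace y (t + h) - trace y t - h *\<^sub>R trace ?y' t) / norm h) \<longlongrightarrow> 0) (at 0)"
  proof (rule tendsto_sandwich [where f = "\<lambda>_. 0" and h = "\<lambda>h. C * \<bar>h\<bar>"])
    have "\<forall>\<^sub>F h in at 0. \<bar>h\<bar> < r"
      using r(1) by (auto simp: eventually_at dist_norm)
    then show "\<forall>\<^sub>F h in at 0. norm (trace y (t + h) - trace y t - h *\<^sub>R trace ?y' t) / norm h \<le> C * \<bar>h\<bar>"
    proof (rule eventually_mp [rotated], intro always_eventually allI impI)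
      fix h :: real assume "\<bar>h\<bar> < r"
      from est [OF this] show "norm (trace y (t + h) - trace y t - h *\<^sub>R trace ?y' t) / norm h \<le> C * \<bar>h\<bar>"
        by (cases "h = 0") (auto simp: divide_simps power2_eq_square mult_ac)
    qed
    show "((\<lambda>h. C * \<bar>h\<bar>) \<longlongrightarrow> 0) (at 0)"
      by (auto intro!: tendsto_eq_intros)
  qed auto
  then show ?thesis
    by (simp add: has_vector_derivative_def has_derivative_at bounded_linear_scaleR_left)
qed

lemma smooth_on_trace:
  assumes "holo_family N y" "of_real ` I \<subseteq> N"
  shows "smooth_on I (trace y)"
  unfolding smooth_on_def
proof (rule exI [of _ "\<lambda>k. trace (\<lambda>n. (deriv ^^ k) (y n))"], intro conjI ballI allI)
  fix k t assume "t \<in> I"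
  then have "(trace (\<lambda>n. (deriv ^^ k) (y n)) has_vector_derivative
          trace (\<lambda>n. deriv ((deriv ^^ k) (y n))) t) (at t)"
    using assms by (intro has_vector_derivative_trace holo_family_iterated_deriv) auto
  then show "(trace (\<lambda>n. (deriv ^^ k) (y n)) has_vector_derivative
          trace (\<lambda>n. (deriv ^^ Suc k) (y n)) t) (at t within I)"
    by (auto intro: has_vector_derivative_at_within)
qed simp

text \<open>Reparameterizations of the curve enter through this lemma. Applied to the family that is
  the identity at every index, it also makes a scalar holomorphic function, such as \<mu>, a
  family.\<close>

lemma holo_family_compose:
  assumes y: "holo_family N y" and phi: "\<phi> holomorphic_on M" and M: "open M"
  shows "holo_family {z \<in> M. \<phi> z \<in> N} (\<lambda>n z. y n (\<phi> z))"
  unfolding holo_family_def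
proof (intro conjI allI ballI)
  have N: "open N" using y by (simp add: holo_family_def)
  have cont: "continuous_on M \<phi>" using phi by (rule holomorphic_on_imp_continuous_on)
  have op: "open {z \<in> M. \<phi> z \<in> A}" if "open A" for A
    using continuous_open_preimage [OF cont M that] by (simp add: vimage_def Int_def)
  show "open {z \<in> M. \<phi> z \<in> N}" using op [OF N] .
  show "(\<lambda>z. y n (\<phi> z)) holomorphic_on {z \<in> M. \<phi> z \<in> N}" for n
    using holomorphic_on_compose_gen [of \<phi> "{z \<in> M. \<phi> z \<in> N}" "y n" N] y phi
    by (auto simp: holo_family_def o_def intro: holomorphic_on_subset)
  fix z assume z: "z \<in> {z \<in> M. \<phi> z \<in> N}"
  then obtain r B where r: "r > 0" "ball (\<phi> z) r \<subseteq> N"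
      and B: "\<And>n w. w \<in> ball (\<phi> z) r \<Longrightarrow> norm (y n w) \<le> B"
    using y unfolding holo_family_def by blast
  have "z \<in> {w \<in> M. \<phi> w \<in> ball (\<phi> z) r}" using z r by simp
  then obtain e where "e > 0" "ball z e \<subseteq> {w \<in> M. \<phi> w \<in> ball (\<phi> z) r}"
    using op [OF open_ball] open_contains_ball by blast
  then have sub: "w \<in> M" "\<phi> w \<in> ball (\<phi> z) r" if "w \<in> ball z e" for w
    using that by auto
  show "\<exists>e>0. \<exists>B. ball z e \<subseteq> {z \<in> M. \<phi> z \<in> N} \<and> (\<forall>n. \<forall>w\<in>ball z e. norm (y n (\<phi> w)) \<le> B)"
  proof (rule exI [of _ e], rule conjI [OF \<open>e > 0\<close>], rule exI [of _ B], rule conjI)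
    show "ball z e \<subseteq> {z \<in> M. \<phi> z \<in> N}"
    proof (rule subsetI)
      fix w assume w: "w \<in> ball z e"
      have "\<phi> w \<in> N" using sub(2) [OF w] r(2) by (rule subsetD [rotated])
      then show "w \<in> {z \<in> M. \<phi> z \<in> N}" using sub(1) [OF w] by simp
    qed
    show "\<forall>n. \<forall>w\<in>ball z e. norm (y n (\<phi> w)) \<le> B"
      by (intro allI ballI B sub)
  qed
qed

section \<open>The contraction\<close>

text \<open>In the contraction, \<open>x n\<close> stands for \<open>U\<^sub>n\<close> if \<open>n < 0\<close> and for \<open>1 - U\<^sub>n\<close> if \<open>n > 0\<close>, while
  \<open>U\<^sub>0 = s\<close>.  The equation at site \<open>0\<close> then reads \<open>\<mu> = mu_of d s x\<close>, and the equation at \<open>n < 0\<close>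
  reads \<open>x n = left_map d s x n\<close>.  The reflection \<open>U\<^sub>n \<mapsto> 1 - U\<^sub>-\<^sub>n\<close>, \<open>\<mu> \<mapsto> 1 - \<mu>\<close> preserves the equation
  and reduces the sites \<open>n > 0\<close> to the sites \<open>n < 0\<close>.\<close>

definition mu_of :: "real \<Rightarrow> complex \<Rightarrow> (int \<Rightarrow> complex) \<Rightarrow> complex" where
  "mu_of d s x = s + of_real d * (1 - x 1 + x (-1) - 2 * s) / (s * (1 - s))"

definition left_map :: "real \<Rightarrow> complex \<Rightarrow> (int \<Rightarrow> complex) \<Rightarrow> int \<Rightarrow> complex" where
  "left_map d s x n = of_real d * ((if n = -1 then s else x (n + 1)) + x (n - 1)) /
     (2 * of_real d + (mu_of d s x - x n) * (1 - x n))"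

text \<open>The entry 0 at site 0 is a placeholder: U_0 = s is prescribed, and neither
  \<open>left_map\<close> at negative sites nor \<open>mu_of\<close> reads \<open>x 0\<close>.
  Fixing it makes the fixed point unique at every site.\<close>

definition front_map :: "real \<Rightarrow> complex \<Rightarrow> (int \<Rightarrow> complex) \<Rightarrow> int \<Rightarrow> complex" where
  "front_map d s x n = (if n < 0 then left_map d s x n
     else if n > 0 then left_map d (1 - s) (\<lambda>k. x (- k)) (- n) else 0)"

text \<open>Stated through strict inequalities in \<open>s\<close>, so that the admissible complex parameters form an
  open set; \<open>mu_of d s (\<lambda>_. 0)\<close> is \<open>\<mu>\<close> to leading order.\<close>

definition left_good :: "real \<Rightarrow> complex \<Rightarrow> bool" where
  "left_good d s \<longleftrightarrow> s \<notin> {0, 1} \<and> norm (of_real d / (s * (1 - s))) < 1 \<and>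
     500 * d < norm (mu_of d s (\<lambda>_. 0)) \<and> norm (mu_of d s (\<lambda>_. 0)) < 2 \<and>
     norm s < 5 * norm (mu_of d s (\<lambda>_. 0))"

definition good :: "real \<Rightarrow> complex set" where
  "good d = {s. left_good d s \<and> left_good d (1 - s)}"

lemma open_good: "open (good d)"
proof -
  have op: "open (- {0, 1 :: complex})"
    by (intro open_Compl finite_imp_closed) auto
  have c1: "continuous_on (- {0, 1}) (\<lambda>s. mu_of d s (\<lambda>_. 0))"
    unfolding mu_of_def by (intro continuous_intros) auto
  have c2: "continuous_on (- {0, 1}) (\<lambda>s. of_real d / (s * (1 - s)) :: complex)"
    by (intro continuous_intros) auto
  have less: "open {s \<in> - {0, 1}. f s < g s}"
    if fg: "continuous_on (- {0, 1}) f" "continuous_on (- {0, 1}) g" for f g :: "complex \<Rightarrow> real"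
  proof -
    obtain A where A: "open A" "A \<inter> - {0, 1} = {s \<in> - {0, 1}. f s < g s}"
      using open_Collect_less_Int [OF fg] by blast
    show ?thesis using open_Int [OF A(1) op] unfolding A(2) .
  qed
  have "{s. left_good d s} = {s \<in> - {0, 1}. norm (of_real d / (s * (1 - s))) < 1}
      \<inter> {s \<in> - {0, 1}. 500 * d < norm (mu_of d s (\<lambda>_. 0))}
      \<inter> {s \<in> - {0, 1}. norm (mu_of d s (\<lambda>_. 0)) < 2}
      \<inter> {s \<in> - {0, 1}. norm s < 5 * norm (mu_of d s (\<lambda>_. 0))}"
    by (auto simp: left_good_def)
  moreover have "open \<dots>"
    by (intro open_Int less continuous_intros c1 c2)
  ultimately have o1: "open {s. left_good d s}" by simp
  have "open ((\<lambda>s. 1 - s) -` {s. left_good d s})"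
    by (intro open_vimage o1 continuous_intros)
  then have "open ({s. left_good d s} \<inter> (\<lambda>s. 1 - s) -` {s. left_good d s})"
    using o1 by blast
  then show ?thesis by (simp add: good_def Int_def vimage_def)
qed

lemma mu_of_reflect:
  assumes "s \<noteq> 0" "s \<noteq> 1"
  shows "mu_of d (1 - s) (\<lambda>k. x (- k)) = 1 - mu_of d s x"
  using assms by (simp add: mu_of_def divide_simps) (simp add: algebra_simps)

section \<open>Bounds and contraction estimate for the fixed point map\<close>

context
  fixes d :: real
  assumes d: "0 < d" "d < 1 / 10 ^ 6"
begin

text \<open>\<open>mu_of\<close> depends on x only through \<open>x (-1) - x 1\<close>, with a
  coefficient of norm below 1 by \<open>left_good\<close>.\<close>

lemma mu_of_diff:
  assumes "left_good d s" "\<And>n. norm (x n - y n) \<le> b"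
  shows "norm (mu_of d s x - mu_of d s y) \<le> 2 * b"
proof -
  have "mu_of d s x - mu_of d s y = of_real d / (s * (1 - s)) * ((x (-1) - y (-1)) - (x 1 - y 1))"
    by (simp add: mu_of_def diff_divide_distrib [symmetric] algebra_simps)
  then have "norm (mu_of d s x - mu_of d s y) =
      norm (of_real d / (s * (1 - s))) * norm ((x (-1) - y (-1)) - (x 1 - y 1))"
    by (simp only: norm_mult)
  also have "\<dots> \<le> 1 * (b + b)"
  proof (rule mult_mono)
    show "norm (of_real d / (s * (1 - s))) \<le> 1"
      using assms(1) by (simp add: left_good_def)
    show "norm ((x (-1) - y (-1)) - (x 1 - y 1)) \<le> b + b"
      by (rule order_trans [OF norm_triangle_ineq4]) (intro add_mono assms)
  qed auto
  finally show ?thesis by simp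
qed

lemma mu_of_bounds:
  assumes "left_good d s" "\<And>n. norm (x n) \<le> 12 * d"
  shows "norm (mu_of d s x - mu_of d s (\<lambda>_. 0)) \<le> 24 * d"
    and "norm (mu_of d s x) \<le> 2 + 24 * d"
    and "norm (mu_of d s (\<lambda>_. 0)) - 24 * d \<le> norm (mu_of d s x)"
proof -
  show 1: "norm (mu_of d s x - mu_of d s (\<lambda>_. 0)) \<le> 24 * d"
    using mu_of_diff [OF assms(1), of x "\<lambda>_. 0" "12 * d"] assms(2) by simp
  show "norm (mu_of d s x) \<le> 2 + 24 * d"
    using 1 assms(1) norm_triangle_ineq2 [of "mu_of d s x" "mu_of d s (\<lambda>_. 0)"]
    by (simp add: left_good_def)
  show "norm (mu_of d s (\<lambda>_. 0)) - 24 * d \<le> norm (mu_of d s x)"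
    using 1 norm_triangle_ineq2 [of "mu_of d s (\<lambda>_. 0)" "mu_of d s x"]
    by (simp add: norm_minus_commute)
qed

text \<open>The denominator is \<mu> up to O(d). Multiplying out leaves a remainder of at most 40 d,
  and replacing x by 0 inside \<open>mu_of\<close> costs another 24 d; the total 64 d is below half
  of the lower bound 500 d for \<mu>.\<close>

lemma denom_bound:
  assumes "left_good d s" "\<And>n. norm (x n) \<le> 12 * d"
  shows "norm (mu_of d s (\<lambda>_. 0)) / 2 \<le> norm (2 * of_real d + (mu_of d s x - x n) * (1 - x n))"
proof -
  let ?M = "mu_of d s x" and ?x = "x n"
  have "norm (?M * ?x) \<le> (2 + 24 * d) * (12 * d)"
    unfolding norm_mult by (intro mult_mono mu_of_bounds assms) (use d in auto)
  also have "\<dots> \<le> 25 * d" using d by (simp add: algebra_simps)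
  finally have 1: "norm (?M * ?x) \<le> 25 * d" .
  have "norm (?x * ?x) \<le> (12 * d) * (12 * d)"
    unfolding norm_mult by (intro mult_mono assms) (use d in auto)
  also have "\<dots> \<le> d" using d by (simp add: algebra_simps)
  finally have 2: "norm (?x * ?x) \<le> d" .
  define R where "R = 2 * of_real d - ?x - ?M * ?x + ?x * ?x"
  have "norm R \<le> 2 * d + 12 * d + 25 * d + d"
    unfolding R_def
    by (intro norm_triangle_le norm_triangle_le_diff add_mono 1 2 assms) (use d in \<open>simp add: norm_mult\<close>)
  moreover have "2 * of_real d + (?M - ?x) * (1 - ?x) = ?M - (- R)"
    by (simp add: R_def algebra_simps)
  ultimately have "norm (2 * of_real d + (?M - ?x) * (1 - ?x)) \<ge> norm ?M - 40 * d"
    using norm_triangle_ineq2 [of ?M "- R"] by simp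
  then show ?thesis
    using mu_of_bounds(3) [of s x, OF assms] assms(1) d by (simp add: left_good_def)
qed

lemma denom_nonzero:
  assumes "left_good d s" "\<And>n. norm (x n) \<le> 12 * d"
  shows "2 * of_real d + (mu_of d s x - x n) * (1 - x n) \<noteq> 0"
  using denom_bound [of s x n, OF assms] assms(1) d by (auto simp: left_good_def)

text \<open>Origin of the radius 12 d: with m the leading value of |\<mu>|, the inner neighbour is
  at most 5m and the denominator at least m/2, which gives 10 d, and the outer neighbour adds only
  24 d^2/m. The second bound keeps the neighbours explicit, for the decay at infinity; its factor
  1/250 bounds 2d/m.\<close>

lemma left_map_bound:
  assumes "left_good d s" "\<And>n. norm (x n) \<le> 12 * d"
  shows "norm (left_map d s x n) < 12 * d"
    and "norm (left_map d s x n) \<le> (norm (if n = -1 then s else x (n + 1)) + norm (x (n - 1))) / 250"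
proof -
  let ?m = "norm (mu_of d s (\<lambda>_. 0))" and ?A = "if n = -1 then s else x (n + 1)"
  let ?D = "2 * of_real d + (mu_of d s x - x n) * (1 - x n)"
  have m: "500 * d < ?m" "0 < ?m" "norm s < 5 * ?m"
    using assms(1) d by (auto simp: left_good_def)
  have "norm (left_map d s x n) = d * norm (?A + x (n - 1)) / norm ?D"
    using d by (simp only: left_map_def norm_divide norm_mult norm_of_real)
  also have "\<dots> \<le> d * norm (?A + x (n - 1)) / (?m / 2)"
    by (rule divide_left_mono [OF denom_bound [of s x n, OF assms]])
      (use m d denom_nonzero [of s x n, OF assms] in auto)
  also have "\<dots> \<le> d * (norm ?A + norm (x (n - 1))) / (?m / 2)"
    by (intro divide_right_mono mult_left_mono norm_triangle_ineq) (use d m in auto)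
  finally have *: "norm (left_map d s x n) \<le> d * (norm ?A + norm (x (n - 1))) / (?m / 2)" .
  have A: "norm ?A \<le> 5 * ?m"
    using assms(2) [of "n + 1"] m d by (cases "n = -1") auto
  have "d * (norm ?A + norm (x (n - 1))) / (?m / 2) \<le> d * (5 * ?m + 12 * d) / (?m / 2)"
    by (intro divide_right_mono mult_left_mono add_mono A assms) (use d m in auto)
  also have "\<dots> < 12 * d"
    using m d by (simp add: field_simps)
  finally show "norm (left_map d s x n) < 12 * d" using * by linarith
  have "d * (norm ?A + norm (x (n - 1))) / (?m / 2) = (norm ?A + norm (x (n - 1))) * (d / (?m / 2))"
    by simp
  also have "\<dots> \<le> (norm ?A + norm (x (n - 1))) * (1 / 250)"
    by (intro mult_left_mono) (use m d in \<open>auto simp: field_simps\<close>)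
  finally show "norm (left_map d s x n) \<le> (norm ?A + norm (x (n - 1))) / 250" using * by simp
qed

lemma left_map_diff:
  assumes s: "left_good d s" and x: "\<And>n. norm (x n) \<le> 12 * d" and y: "\<And>n. norm (y n) \<le> 12 * d"
    and b: "\<And>n. norm (x n - y n) \<le> b"
  shows "norm (left_map d s x n - left_map d s y n) \<le> b / 2"
proof -
  define m where "m = norm (mu_of d s (\<lambda>_. 0))"
  define P where "P = (if n = -1 then s else x (n + 1)) + x (n - 1)"
  define Q where "Q = (if n = -1 then s else y (n + 1)) + y (n - 1)"
  define D where "D = 2 * of_real d + (mu_of d s x - x n) * (1 - x n)"
  define E where "E = 2 * of_real d + (mu_of d s y - y n) * (1 - y n)"
  have m: "500 * d < m" "0 < m" "norm s < 5 * m"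
    using s d by (auto simp: left_good_def m_def)
  have b0: "0 \<le> b" using b norm_ge_zero order_trans by blast
  have D: "m / 2 \<le> norm D" "D \<noteq> 0" and E: "m / 2 \<le> norm E" "E \<noteq> 0"
    using denom_bound [of s x n, OF s x] denom_nonzero [of s x n, OF s x]
      denom_bound [of s y n, OF s y] denom_nonzero [of s y n, OF s y]
    by (auto simp: D_def E_def m_def)
  have "P - Q = (if n = -1 then 0 else x (n + 1) - y (n + 1)) + (x (n - 1) - y (n - 1))"
    by (simp add: P_def Q_def)
  also have "norm \<dots> \<le> b + b"
    by (intro norm_triangle_le add_mono) (use b b0 in auto)
  finally have PQ: "norm (P - Q) \<le> 2 * b" by simp
  have Q: "norm Q \<le> 6 * m"
  proof -
    have "norm Q \<le> 5 * m + 12 * d"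
      unfolding Q_def
      by (intro norm_triangle_le add_mono y) (use m y [of "n + 1"] d in auto)
    then show ?thesis using m d by linarith
  qed
  \<comment> \<open>The two denominators differ through \<mu>, by about 2b, and through
    \<open>x n\<close>, by about 3b; 6b leaves room for the terms of order b d.\<close>
  have "E - D = (mu_of d s y - mu_of d s x) * (1 - y n) + (x n - y n) * (mu_of d s x + 1 - x n - y n)"
    by (simp add: D_def E_def algebra_simps)
  also have "norm \<dots> \<le> (2 * b) * (1 + 12 * d) + b * ((2 + 24 * d) + 1 + 12 * d + 12 * d)"
  proof (intro norm_triangle_le add_mono)
    show "norm ((mu_of d s y - mu_of d s x) * (1 - y n)) \<le> (2 * b) * (1 + 12 * d)"
      unfolding norm_mult
    proof (intro mult_mono)
      show "norm (mu_of d s y - mu_of d s x) \<le> 2 * b"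
        by (rule mu_of_diff [OF s]) (use b in \<open>simp add: norm_minus_commute\<close>)
      show "norm (1 - y n) \<le> 1 + 12 * d"
        using norm_triangle_ineq4 [of 1 "y n"] y [of n] by simp
    qed (use b0 in auto)
    show "norm ((x n - y n) * (mu_of d s x + 1 - x n - y n)) \<le> b * ((2 + 24 * d) + 1 + 12 * d + 12 * d)"
      unfolding norm_mult
    proof (intro mult_mono b)
      show "norm (mu_of d s x + 1 - x n - y n) \<le> (2 + 24 * d) + 1 + 12 * d + 12 * d"
        by (intro norm_triangle_le norm_triangle_le_diff add_mono x y mu_of_bounds(2) [OF s]) auto
    qed (use b0 in auto)
  qed
  also have "\<dots> \<le> 6 * b"
  proof -
    have "b * d \<le> b * (1 / 10 ^ 6)" using d b0 by (intro mult_left_mono) auto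
    then show ?thesis using b0 by (simp add: algebra_simps)
  qed
  finally have ED: "norm (E - D) \<le> 6 * b" .
  have "left_map d s x n - left_map d s y n = of_real d * P / D - of_real d * Q / E"
    by (simp add: left_map_def P_def Q_def D_def E_def)
  \<comment> \<open>Quotient rule. The first term contributes 4 (d/m) b, the second 144 (d/m) b, and
    d/m < 1/500 brings 148 (d/m) b below b/2.\<close>
  also have "\<dots> = of_real d * (P - Q) / D + of_real d * Q * (E - D) / (D * E)"
    using D E by (simp add: field_simps)
  also have "norm \<dots> \<le> d * (2 * b) / (m / 2) + d * (6 * m) * (6 * b) / ((m / 2) * (m / 2))"
    unfolding norm_mult norm_divide
    apply (intro norm_triangle_le add_mono)
    subgoal
      unfolding norm_mult norm_divide
      by (intro frac_le mult_mono PQ D) (use d m b0 in auto)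
    subgoal
      unfolding norm_mult norm_divide
      by (intro frac_le mult_mono Q ED D E mult_pos_pos mult_nonneg_nonneg) (use d m b0 in auto)
    done
  also have "\<dots> = 148 * (d / m) * b"
    using m by (simp add: field_simps)
  also have "\<dots> \<le> 148 * (1 / 500) * b"
    using m d b0 by (intro mult_right_mono mult_left_mono) (auto simp: field_simps)
  also have "\<dots> \<le> b / 2" using b0 by simp
  finally show ?thesis .
qed

lemma front_map_bound:
  assumes "s \<in> good d" "\<And>n. norm (x n) \<le> 12 * d"
  shows "norm (front_map d s x n) < 12 * d"
  using left_map_bound(1) assms d by (auto simp: front_map_def good_def)

lemma front_map_diff:
  assumes "s \<in> good d" "\<And>n. norm (x n) \<le> 12 * d" "\<And>n. norm (y n) \<le> 12 * d"
    "\<And>n. norm (x n - y n) \<le> b"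
  shows "norm (front_map d s x n - front_map d s y n) \<le> b / 2"
proof -
  have "0 \<le> b" using assms(4) norm_ge_zero order_trans by blast
  then show ?thesis
    using left_map_diff assms by (auto simp: front_map_def good_def)
qed

section \<open>Picard iterates and the fixed point\<close>

definition iter_dev :: "nat \<Rightarrow> complex \<Rightarrow> int \<Rightarrow> complex" where
  "iter_dev k s = (front_map d s ^^ k) (\<lambda>_. 0)"

text \<open>The limit of the iterates, written as a telescoping series so that the Weierstrass
  M-test applies and gives convergence uniform on all of \<open>good d\<close>.\<close>

definition deviation :: "complex \<Rightarrow> int \<Rightarrow> complex" where
  "deviation s n = (\<Sum>k. iter_dev (Suc k) s n - iter_dev k s n)"

lemma iter_dev_0 [simp]: "iter_dev 0 s n = 0"
  and iter_dev_Suc: "iter_dev (Suc k) s = front_map d s (iter_dev k s)"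
  by (simp_all add: iter_dev_def)

lemma iter_dev_bound:
  assumes "s \<in> good d"
  shows "norm (iter_dev k s n) \<le> 12 * d"
  by (induction k arbitrary: n) (use d front_map_bound [OF assms] in \<open>auto simp: iter_dev_Suc less_imp_le\<close>)

lemma iter_dev_diff:
  assumes "s \<in> good d"
  shows "norm (iter_dev (Suc k) s n - iter_dev k s n) \<le> 12 * d * (1 / 2) ^ k"
proof (induction k arbitrary: n)
  case 0
  show ?case using iter_dev_bound [OF assms, of "Suc 0"] by simp
next
  case (Suc k)
  show ?case
    using front_map_diff [of s "iter_dev (Suc k) s" "iter_dev k s" _ n,
        OF assms iter_dev_bound [OF assms] iter_dev_bound [OF assms] Suc.IH]
    by (simp add: iter_dev_Suc)
qed

lemma iter_dev_uniform_limit: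
  "uniform_limit (good d) (\<lambda>k s. iter_dev k s n) (\<lambda>s. deviation s n) sequentially"
proof -
  have "uniform_limit (good d) (\<lambda>k s. \<Sum>i<k. iter_dev (Suc i) s n - iter_dev i s n)
     (\<lambda>s. deviation s n) sequentially"
    unfolding deviation_def
    by (rule Weierstrass_m_test [OF iter_dev_diff]) (auto intro!: summable_mult summable_geometric)
  moreover have "(\<Sum>i<k. iter_dev (Suc i) s n - iter_dev i s n) = iter_dev k s n" for k s
    using sum_lessThan_telescope [of "\<lambda>i. iter_dev i s n" k] by simp
  ultimately show ?thesis by simp
qed

lemma iter_dev_tendsto:
  assumes "s \<in> good d"
  shows "(\<lambda>k. iter_dev k s n) \<longlonglongrightarrow> deviation s n"
  using tendsto_uniform_limitI [OF iter_dev_uniform_limit assms] .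

lemma deviation_le:
  assumes "s \<in> good d"
  shows "norm (deviation s n) \<le> 12 * d"
  by (rule Lim_norm_ubound [OF _ iter_dev_tendsto [OF assms]])
    (auto simp: iter_dev_bound [OF assms])

lemma mu_of_tendsto:
  assumes "\<And>n. (\<lambda>k. f k n) \<longlonglongrightarrow> x n" "s \<noteq> 0" "s \<noteq> 1"
  shows "(\<lambda>k. mu_of d s (f k)) \<longlonglongrightarrow> mu_of d s x"
  unfolding mu_of_def by (intro tendsto_intros assms) (use assms in auto)

lemma left_map_tendsto:
  assumes "\<And>n. (\<lambda>k. f k n) \<longlonglongrightarrow> x n" "left_good d s" "\<And>n. norm (x n) \<le> 12 * d"
  shows "(\<lambda>k. left_map d s (f k) n) \<longlonglongrightarrow> left_map d s x n"
proof -
  have A: "(\<lambda>k. if n = -1 then s else f k (n + 1)) \<longlonglongrightarrow> (if n = -1 then s else x (n + 1))"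
    using assms(1) by simp
  show ?thesis
    unfolding left_map_def
    by (intro tendsto_intros A mu_of_tendsto assms denom_nonzero) (use assms(2) in \<open>auto simp: left_good_def\<close>)
qed

lemma front_map_deviation:
  assumes "s \<in> good d"
  shows "front_map d s (deviation s) = deviation s"
proof
  fix n
  have "(\<lambda>k. front_map d s (iter_dev k s) n) \<longlonglongrightarrow> front_map d s (deviation s) n"
    using assms unfolding front_map_def good_def
    by (auto intro!: left_map_tendsto iter_dev_tendsto deviation_le simp: good_def)
  moreover have "(\<lambda>k. front_map d s (iter_dev k s) n) \<longlonglongrightarrow> deviation s n"
    using LIMSEQ_Suc [OF iter_dev_tendsto [OF assms, of n]] by (simp add: iter_dev_Suc)
  ultimately show "front_map d s (deviation s) n = deviation s n"
    by (rule LIMSEQ_unique)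
qed

text \<open>The strict form is what places a front inside the open set \<open>window\<close>, which
  is cut out by strict inequalities.\<close>

lemma deviation_less:
  assumes "s \<in> good d"
  shows "norm (deviation s n) < 12 * d"
  using front_map_bound [of s "deviation s" n, OF assms deviation_le [OF assms]] by (simp add: front_map_deviation [OF assms])

lemma deviation_unique:
  assumes s: "s \<in> good d" and x: "\<And>n. norm (x n) \<le> 12 * d" and fp: "front_map d s x = x"
  shows "x = deviation s"
proof
  fix n
  \<comment> \<open>Both sequences lie in the ball of radius 12 d, hence 24 d at the start; each
    application of the map, which fixes both, halves the bound.\<close>
  have est: "norm (x n - deviation s n) \<le> 24 * d * (1 / 2) ^ k" for k n
  proof (induction k arbitrary: n)
    case 0
    show ?case
      using norm_triangle_ineq4 [of "x n" "deviation s n"] x [of n] deviation_le [OF s, of n] by simp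
  next
    case (Suc k)
    show ?case
      using front_map_diff [of s x "deviation s" _ n, OF s x deviation_le [OF s] Suc.IH] by (simp add: fp front_map_deviation [OF s])
  qed
  have "(\<lambda>k. 24 * d * (1 / 2) ^ k) \<longlonglongrightarrow> 24 * d * 0"
    by (intro tendsto_intros LIMSEQ_power_zero) auto
  then have "norm (x n - deviation s n) \<le> 24 * d * 0"
    by (rule LIMSEQ_le_const) (use est in auto)
  then show "x n = deviation s n" by simp
qed

section \<open>Holomorphic dependence on the parameter, and real values at real parameters\<close>

lemma holomorphic_mu_of:
  assumes "\<And>n. (\<lambda>s. f s n) holomorphic_on N" "g holomorphic_on N"
    "\<And>s. s \<in> N \<Longrightarrow> g s \<notin> {0, 1}"
  shows "(\<lambda>s. mu_of d (g s) (f s)) holomorphic_on N"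
  unfolding mu_of_def by (intro holomorphic_intros assms) (use assms(3) in auto)

lemma holomorphic_left_map:
  assumes "\<And>n. (\<lambda>s. f s n) holomorphic_on N" "g holomorphic_on N"
    "\<And>s. s \<in> N \<Longrightarrow> left_good d (g s)" "\<And>s n. s \<in> N \<Longrightarrow> norm (f s n) \<le> 12 * d"
  shows "(\<lambda>s. left_map d (g s) (f s) n) holomorphic_on N"
proof -
  have A: "(\<lambda>s. if n = -1 then g s else f s (n + 1)) holomorphic_on N"
    using assms by (cases "n = -1") auto
  show ?thesis
    unfolding left_map_def
    by (intro holomorphic_intros A holomorphic_mu_of assms denom_nonzero)
      (use assms(3) in \<open>auto simp: left_good_def\<close>)
qed

lemma holomorphic_iter_dev: "(\<lambda>s. iter_dev k s n) holomorphic_on good d"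
proof (induction k arbitrary: n)
  case (Suc k)
  have "(\<lambda>s. left_map d s (iter_dev k s) n) holomorphic_on good d"
    by (intro holomorphic_left_map Suc.IH iter_dev_bound holomorphic_intros) (auto simp: good_def)
  moreover have "(\<lambda>s. left_map d (1 - s) (\<lambda>j. iter_dev k s (- j)) (- n)) holomorphic_on good d"
    by (intro holomorphic_left_map Suc.IH iter_dev_bound holomorphic_intros) (auto simp: good_def)
  ultimately show ?case
    by (cases "n < 0"; cases "n > 0") (simp_all add: iter_dev_Suc front_map_def)
qed simp

lemma holomorphic_deviation: "(\<lambda>s. deviation s n) holomorphic_on good d"
proof (rule holomorphic_uniform_sequence [OF open_good holomorphic_iter_dev])
  fix z assume "z \<in> good d"
  then obtain e where "e > 0" "cball z e \<subseteq> good d"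
    using open_good open_contains_cball by blast
  then show "\<exists>e>0. cball z e \<subseteq> good d \<and>
      uniform_limit (cball z e) (\<lambda>k s. iter_dev k s n) (\<lambda>s. deviation s n) sequentially"
    using uniform_limit_on_subset [OF iter_dev_uniform_limit] by blast
qed

text \<open>The iteration uses only field operations with real coefficients and starts at 0. Hence
  the real parts taken in \<open>trace\<close> and \<open>mu\<close> lose nothing at real
  parameters.\<close>

lemma iter_dev_Reals: "iter_dev k (of_real s) n \<in> \<real>"
proof (induction k arbitrary: n)
  case (Suc k)
  have "left_map d r x n \<in> \<real>" if "r \<in> \<real>" "\<And>n. x n \<in> \<real>" for r x n
  proof -
    have A: "(if n = -1 then r else x (n + 1)) \<in> \<real>" using that by simp
    show ?thesis
      unfolding left_map_def mu_of_def
      by (intro Reals_divide Reals_mult Reals_add Reals_diff A that Reals_of_real Reals_1 Reals_numeral)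
  qed
  then show ?case
    using Suc.IH by (auto simp: iter_dev_Suc front_map_def)
qed simp

lemma deviation_Reals:
  assumes "of_real s \<in> good d"
  shows "deviation (of_real s) n \<in> \<real>"
  by (rule closed_sequentially [OF closed_complex_Reals iter_dev_Reals iter_dev_tendsto [OF assms]])

end

section \<open>The fronts\<close>

text \<open>The factor 3/2 lies between two constraints: it must exceed 1, since
  \<open>left_good\<close> asks for d/(s(1-s)) < 1, and stay below 2, so that the joining values
  near 2d and 1 - 2d are interior.\<close>

definition params :: "real \<Rightarrow> real set" where
  "params d = {3 / 2 * d <..< 1 - 3 / 2 * d}"

text \<open>Partial fraction form of \<open>mu_of\<close> at x = 0, which separates the
  singularities at s = 0 and s = 1.\<close>

definition lead_mu :: "real \<Rightarrow> real \<Rightarrow> real" where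
  "lead_mu d s = s + d / s - d / (1 - s)"

definition profile :: "real \<Rightarrow> int \<Rightarrow> complex \<Rightarrow> complex" where
  "profile d n s = (if n < 0 then deviation d s n else if n = 0 then s else 1 - deviation d s n)"

definition front :: "real \<Rightarrow> real \<Rightarrow> linf" where
  "front d = trace (profile d)"

definition mu :: "real \<Rightarrow> real \<Rightarrow> real" where
  "mu d s = Re (mu_of d (of_real s) (deviation d (of_real s)))"

lemma params_reflect: "s \<in> params d \<Longrightarrow> 1 - s \<in> params d"
  by (auto simp: params_def)

lemma lead_mu_reflect: "lead_mu d (1 - s) = 1 - lead_mu d s"
  by (simp add: lead_mu_def)

lemma mu_of_0:
  assumes "s \<noteq> 0" "s \<noteq> 1"
  shows "mu_of d (of_real s) (\<lambda>_. 0) = of_real (lead_mu d s)"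
proof -
  have "lead_mu d s = s + d * (1 - 2 * s) / (s * (1 - s))"
    using assms by (simp add: lead_mu_def divide_simps) (simp add: algebra_simps)
  then show ?thesis by (simp add: mu_of_def)
qed

context
  fixes d :: real
  assumes d: "0 < d" "d < 1 / 10 ^ 6"
begin

lemma lead_mu_bounds:
  assumes "s \<in> params d"
  shows "500 * d < lead_mu d s" "lead_mu d s < 2" "s < 5 * lead_mu d s"
    and "d / (s * (1 - s)) < 1"
proof -
  have s: "0 < s" "s < 1" "3 / 2 * d < s" "s < 1 - 3 / 2 * d"
    using assms d by (auto simp: params_def)
  have "d / s < 2 / 3" "d / (1 - s) < 2 / 3" "0 < d / s" "0 < d / (1 - s)"
    using s d by (auto simp: field_simps)
  note b = this
  have q: "d / (s * (1 - s)) = d / s + d / (1 - s)"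
    using s by (simp add: divide_simps) (simp add: algebra_simps)
  have "500 * d < lead_mu d s \<and> s < 5 * lead_mu d s \<and> d / (s * (1 - s)) < 1"
  proof (cases "s \<le> 1 / 2")
    case True
    then have "d * (1 / (1 - s)) \<le> d * 2"
      using d s by (intro mult_left_mono) (auto simp: field_simps)
    then have 1: "d / (1 - s) \<le> 2 * d" by simp
    \<comment> \<open>This outweighs the loss d/(1-s), so that \<open>lead_mu d s\<close> is at
      least s.\<close>
    have "2 * d \<le> d / s"
      using True s d by (simp add: field_simps)
    moreover have "600 * d < s + d / s"
    proof (cases "600 * d < s")
      case False
      \<comment> \<open>Here s is at most 600 d, so 600 s is at most 360000 d, which is below
        1.\<close>
      then have "600 * d \<le> d / s" using s d mult_mono [of s "600 * d" 600 600]
        by (simp add: field_simps)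
      then show ?thesis using s by simp
    qed (use b in simp)
    ultimately show ?thesis
      using 1 b d s unfolding lead_mu_def q by auto
  next
    case False
    then have "d * (1 / s) \<le> d * 2"
      using d s by (intro mult_left_mono) (auto simp: field_simps)
    then have 1: "d / s \<le> 2 * d" by simp
    \<comment> \<open>Source of the factor 5 in \<open>left_good\<close>, as s < 1. For s > 9/10 the
      term d/(1-s) may approach 2/3, and 9/10 - 2/3 still exceeds 1/5; for smaller s it is at most
      10 d.\<close>
    have "1 / 5 < lead_mu d s"
    proof (cases "s \<le> 9 / 10")
      case True
      then have "d * (1 / (1 - s)) \<le> d * 10"
        using d s by (intro mult_left_mono) (auto simp: field_simps)
      then have "d / (1 - s) \<le> d * 10" "d * 10 < 1 / 10" using d by auto
      then show ?thesis
        using b False unfolding lead_mu_def by linarith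
    next
      case False
      then show ?thesis using b unfolding lead_mu_def by simp
    qed
    then show ?thesis
      using 1 b d s unfolding q by auto
  qed
  then show "500 * d < lead_mu d s" "s < 5 * lead_mu d s" "d / (s * (1 - s)) < 1"
    by auto
  show "lead_mu d s < 2"
    using b s unfolding lead_mu_def by linarith
qed

lemma params_imp_left_good:
  assumes "s \<in> params d"
  shows "left_good d (of_real s)"
proof -
  have s: "0 < s" "s < 1" using assms d by (auto simp: params_def)
  have "of_real d / (of_real s * (1 - of_real s)) = complex_of_real (d / (s * (1 - s)))"
    by simp
  then have "norm (of_real d / (of_real s * (1 - of_real s)) :: complex) = d / (s * (1 - s))"
    using s d by (simp only: norm_of_real) simp
  moreover have "norm (mu_of d (of_real s) (\<lambda>_. 0)) = lead_mu d s"
    using mu_of_0 [of s d] s lead_mu_bounds(1) [OF assms] d by simp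
  ultimately show ?thesis
    using lead_mu_bounds [OF assms] s by (auto simp: left_good_def)
qed

lemma params_imp_good:
  assumes "s \<in> params d"
  shows "of_real s \<in> good d"
  using params_imp_left_good [OF assms] params_imp_left_good [OF params_reflect [OF assms]]
  by (simp add: good_def)

section \<open>Steady states as fixed points\<close>

text \<open>At site 0 the equation is affine in M with slope -s(1-s), nonzero, so it fixes M. At any
  other site the residual is, up to sign, the numerator of the map minus \<open>x n\<close> times a
  nonvanishing denominator. The direction from right to left gives existence of fronts, the other
  one their uniqueness.\<close>

lemma steady_iff:
  assumes s: "s \<in> good d" and x: "\<And>n. norm (x n) \<le> 12 * d" and x0: "x 0 = 0"
    and U: "\<And>n. U n = (if n < 0 then x n else if n = 0 then s else 1 - x n)"
  shows "(\<forall>n. of_real d * (U (n + 1) + U (n - 1) - 2 * U n) + U n * (U n - M) * (1 - U n) = 0)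
     \<longleftrightarrow> M = mu_of d s x \<and> front_map d s x = x"
proof -
  define eq where "eq n = of_real d * (U (n + 1) + U (n - 1) - 2 * U n) + U n * (U n - M) * (1 - U n)" for n
  have s': "left_good d s" "left_good d (1 - s)" "s \<noteq> 0" "s \<noteq> 1"
    using s by (auto simp: good_def left_good_def)
  have zero: "eq 0 = 0 \<longleftrightarrow> M = mu_of d s x"
  proof -
    have "eq 0 = s * (1 - s) * (mu_of d s x - M)"
      using s' by (simp add: eq_def U mu_of_def field_simps)
    then show ?thesis using s' by auto
  qed
  have neg: "eq n = 0 \<longleftrightarrow> front_map d s x n = x n" if M: "M = mu_of d s x" and n: "n < 0" for n
  proof -
    define D where "D = 2 * of_real d + (mu_of d s x - x n) * (1 - x n)"
    have D: "D \<noteq> 0" unfolding D_def by (rule denom_nonzero [OF d s'(1) x])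
    have "front_map d s x n = of_real d * (U (n + 1) + U (n - 1)) / D"
      using n by (auto simp: front_map_def left_map_def U D_def)
    moreover have "eq n = of_real d * (U (n + 1) + U (n - 1)) - x n * D"
      using n by (simp add: eq_def U [of n] D_def M algebra_simps)
    ultimately show ?thesis using D by (auto simp: nonzero_divide_eq_eq)
  qed
  have pos: "eq n = 0 \<longleftrightarrow> front_map d s x n = x n" if M: "M = mu_of d s x" and n: "0 < n" for n
  proof -
    define D where "D = 2 * of_real d + (1 - mu_of d s x - x n) * (1 - x n)"
    have D: "D \<noteq> 0"
      using denom_nonzero [OF d s'(2), of "\<lambda>k. x (- k)" "- n"] x s'
      by (simp add: D_def mu_of_reflect)
    have "front_map d s x n = of_real d * ((1 - U (n - 1)) + (1 - U (n + 1))) / D"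
      using n s' by (auto simp: front_map_def left_map_def U D_def mu_of_reflect add_ac)
    moreover have "eq n = x n * D - of_real d * ((1 - U (n - 1)) + (1 - U (n + 1)))"
      using n by (simp add: eq_def U [of n] D_def M algebra_simps)
    ultimately show ?thesis using D by (auto simp: nonzero_divide_eq_eq)
  qed
  have "(\<forall>n. eq n = 0) \<longleftrightarrow> M = mu_of d s x \<and> front_map d s x = x"
  proof
    assume all: "\<forall>n. eq n = 0"
    then have M: "M = mu_of d s x" using zero by blast
    have "front_map d s x n = x n" for n
      using all neg [OF M, of n] pos [OF M, of n] x0
      by (cases n "0 :: int" rule: linorder_cases) (auto simp: front_map_def)
    then show "M = mu_of d s x \<and> front_map d s x = x" using M by auto
  next
    assume R: "M = mu_of d s x \<and> front_map d s x = x"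
    show "\<forall>n. eq n = 0"
    proof
      fix n show "eq n = 0"
        using R neg [of n] pos [of n] zero
        by (cases n "0 :: int" rule: linorder_cases) auto
    qed
  qed
  then show ?thesis by (simp add: eq_def)
qed

lemma deviation_0: "s \<in> good d \<Longrightarrow> deviation d s 0 = 0"
  using front_map_deviation [OF d, of s] by (metis (no_types) less_irrefl front_map_def)

lemma holo_family_profile: "holo_family (good d) (profile d)"
  unfolding holo_family_def
proof (intro conjI allI ballI)
  show "open (good d)" by (rule open_good)
  show "profile d n holomorphic_on good d" for n
  proof -
    have "(\<lambda>s. if n < 0 then deviation d s n else if n = 0 then s else 1 - deviation d s n) holomorphic_on good d"
      using holomorphic_deviation [OF d, of n]
      by (cases "n < 0"; cases "n = 0") (auto intro!: holomorphic_intros)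
    then show ?thesis by (simp add: profile_def [abs_def])
  qed
  fix z assume "z \<in> good d"
  then obtain r where r: "r > 0" "ball z r \<subseteq> good d"
    using open_good open_contains_ball by blast
  have "norm (profile d n w) \<le> norm z + r + 2" if w: "w \<in> ball z r" for n w
  proof -
    have "norm (deviation d w n) \<le> 12 * d" using r w deviation_le [OF d] by blast
    moreover have "norm (1 - deviation d w n) \<le> 1 + norm (deviation d w n)"
      using norm_triangle_ineq4 [of 1 "deviation d w n"] by simp
    moreover have "norm w \<le> norm z + r"
      using w norm_triangle_sub [of w z] by (simp add: dist_norm norm_minus_commute)
    ultimately show ?thesis
      using r(1) d norm_ge_zero [of z] by (auto simp: profile_def simp del: norm_ge_zero)
  qed
  then show "\<exists>r>0. \<exists>B. ball z r \<subseteq> good d \<and> (\<forall>n. \<forall>w\<in>ball z r. norm (profile d n w) \<le> B)"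
    using r by blast
qed

lemma front_apply:
  assumes "s \<in> params d"
  shows "front d s n = Re (profile d n (of_real s))"
  unfolding front_def by (rule trace_apply [OF holo_family_profile params_imp_good [OF assms]])

lemma profile_of_real:
  assumes "s \<in> params d"
  shows "profile d n (of_real s) = of_real (front d s n)"
proof -
  have "profile d n (of_real s) \<in> \<real>"
    using deviation_Reals [OF d params_imp_good [OF assms]] by (auto simp: profile_def)
  then show ?thesis
    by (simp add: front_apply [OF assms] of_real_Re)
qed

lemma mu_of_of_real:
  assumes "s \<in> params d"
  shows "mu_of d (of_real s) (deviation d (of_real s)) = of_real (mu d s)"
proof -
  have "mu_of d (of_real s) (deviation d (of_real s)) \<in> \<real>"
    unfolding mu_of_def
    by (intro Reals_add Reals_diff Reals_mult Reals_divide Reals_of_real Reals_1 Reals_numeral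
        deviation_Reals [OF d params_imp_good [OF assms]])
  then show ?thesis by (simp add: mu_def of_real_Re)
qed

lemma front_0 [simp]: "s \<in> params d \<Longrightarrow> front d s 0 = s"
  by (simp add: front_apply profile_def)

lemma front_neg:
  assumes "s \<in> params d" "n < 0"
  shows "\<bar>front d s n\<bar> < 12 * d"
  using deviation_less [OF d params_imp_good [OF assms(1)], of n] profile_of_real [OF assms(1), of n] assms(2)
  by (simp add: profile_def)

lemma front_pos:
  assumes "s \<in> params d" "n > 0"
  shows "\<bar>1 - front d s n\<bar> < 12 * d"
proof -
  have "deviation d (of_real s) n = 1 - profile d n (of_real s)"
    using assms(2) by (simp add: profile_def)
  also have "\<dots> = of_real (1 - front d s n)"
    using profile_of_real [OF assms(1), of n] by simp
  finally have "deviation d (of_real s) n = of_real (1 - front d s n)" .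
  then show ?thesis
    using deviation_less [OF d params_imp_good [OF assms(1)], of n] by (simp only: norm_of_real)
qed

lemma nagumo_steady_complex:
  "nagumo_steady d U \<mu> \<longleftrightarrow> (\<forall>n. of_real d * (of_real (U (n + 1)) + of_real (U (n - 1)) - 2 * of_real (U n))
      + of_real (U n) * (of_real (U n) - of_real \<mu>) * (1 - of_real (U n)) = (0 :: complex))"
proof -
  have "of_real d * (of_real (U (n + 1)) + of_real (U (n - 1)) - 2 * of_real (U n))
      + of_real (U n) * (of_real (U n) - of_real \<mu>) * (1 - of_real (U n)) =
      complex_of_real (d * (U (n + 1) + U (n - 1) - 2 * U n) + U n * (U n - \<mu>) * (1 - U n))" for n
    by simp
  then show ?thesis
    unfolding nagumo_steady_def by (simp only: of_real_eq_0_iff) (metis)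
qed

lemma front_steady:
  assumes "s \<in> params d"
  shows "nagumo_steady d (front d s) (mu d s)"
proof -
  have g: "of_real s \<in> good d" by (rule params_imp_good [OF assms])
  show ?thesis
    unfolding nagumo_steady_complex
  proof (subst steady_iff [where s = "of_real s" and x = "deviation d (of_real s)"
        and U = "\<lambda>n. of_real (front d s n)", OF g deviation_le [OF d g] deviation_0 [OF g]])
    show "of_real (front d s n) =
        (if n < 0 then deviation d (of_real s) n else if n = 0 then of_real s else 1 - deviation d (of_real s) n)" for n
      using profile_of_real [OF assms, of n] by (simp add: profile_def)
    show "of_real (mu d s) = mu_of d (of_real s) (deviation d (of_real s)) \<and>
        front_map d (of_real s) (deviation d (of_real s)) = deviation d (of_real s)"
      using mu_of_of_real [OF assms] front_map_deviation [OF d g] by simp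
  qed
qed

lemma front_unique:
  assumes U: "nagumo_steady d U \<mu>" and s: "U 0 \<in> params d"
    and neg: "\<And>n. n < 0 \<Longrightarrow> \<bar>U n\<bar> \<le> 12 * d" and pos: "\<And>n. n > 0 \<Longrightarrow> \<bar>1 - U n\<bar> \<le> 12 * d"
  shows "U = front d (U 0)" and "\<mu> = mu d (U 0)"
proof -
  define s where "s = complex_of_real (U 0)"
  define x where "x n = (if n < 0 then complex_of_real (U n) else if n = 0 then 0 else 1 - complex_of_real (U n))" for n :: int
  have g: "s \<in> good d" unfolding s_def by (rule params_imp_good [OF s])
  have x: "norm (x n) \<le> 12 * d" for n
  proof -
    have "norm (1 - complex_of_real (U n)) = \<bar>1 - U n\<bar>"
      using norm_of_real [of "1 - U n", where 'a = complex] by simp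
    then show ?thesis using neg [of n] pos [of n] d by (auto simp: x_def)
  qed
  have x0: "x 0 = 0" by (simp add: x_def)
  have Ux: "of_real (U n) = (if n < 0 then x n else if n = 0 then s else 1 - x n)" for n
    by (simp add: x_def s_def)
  have *: "of_real \<mu> = mu_of d s x \<and> front_map d s x = x"
    using U unfolding nagumo_steady_complex
    by (subst (asm) steady_iff [where s = s and x = x and U = "\<lambda>n. of_real (U n)", OF g x x0 Ux])
  then have xd: "x = deviation d s" using deviation_unique [of d s x, OF d g x] by blast
  then have "of_real \<mu> = mu_of d s (deviation d s)" using * by simp
  then show "\<mu> = mu d (U 0)"
    using mu_of_of_real [OF s] by (simp add: s_def)
  show "U = front d (U 0)"
  proof (rule bcontfun_eqI)
    fix n
    have "complex_of_real (U n) = profile d n s"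
      by (simp add: Ux profile_def xd)
    then show "U n = front d (U 0) n"
      using profile_of_real [OF s, of n] by (simp add: s_def)
  qed
qed

lemma mu_near_lead_mu:
  assumes "s \<in> params d"
  shows "\<bar>mu d s - lead_mu d s\<bar> \<le> 24 * d"
proof -
  have s: "s \<noteq> 0" "s \<noteq> 1" using assms d by (auto simp: params_def)
  have "norm (mu_of d (of_real s) (deviation d (of_real s)) - mu_of d (of_real s) (\<lambda>_. 0)) \<le> 24 * d"
    by (rule mu_of_bounds [OF d params_imp_left_good deviation_le [OF d params_imp_good]]) fact+
  then show ?thesis
    using mu_of_of_real [OF assms] mu_of_0 [OF s, of d]
    by (simp flip: of_real_diff)
qed

text \<open>The leading value exceeds 500 d and the error is at most 24 d, so \<mu> > 0; the same
  bound at the reflected parameter 1 - s gives \<mu> < 1.\<close>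

lemma mu_bounds:
  assumes "s \<in> params d"
  shows "0 < mu d s" "mu d s < 1"
  using mu_near_lead_mu [OF assms] lead_mu_bounds(1) [OF assms] lead_mu_bounds(1) [OF params_reflect [OF assms]] d
  unfolding lead_mu_reflect by linarith+

text \<open>By the second part of \<open>left_map_bound\<close> each entry is at most 1/250 of the
  sum of its neighbours, which are at distance at least k from site 0 if the entry is at distance at
  least k + 1. This gives far more than the factor 1/2 per site.\<close>

lemma deviation_decay:
  assumes s: "s \<in> good d" "norm s \<le> 1" "norm (1 - s) \<le> 1"
  shows "int k \<le> \<bar>n\<bar> \<Longrightarrow> norm (deviation d s n) \<le> (1 / 2) ^ k"
proof (induction k arbitrary: n)
  case 0
  show ?case using deviation_le [OF d s(1), of n] d by simp
next
  case (Suc k)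
  have s': "left_good d s" "left_good d (1 - s)" using s by (auto simp: good_def)
  have one: "norm (left_map d r x m) \<le> (1 / 2) ^ Suc k"
    if r: "left_good d r" "norm r \<le> 1" and m: "m < 0" "int (Suc k) \<le> - m"
      and x: "\<And>n. norm (x n) \<le> 12 * d" "\<And>n. int k \<le> \<bar>n\<bar> \<Longrightarrow> norm (x n) \<le> (1 / 2) ^ k" for r x m
  proof -
    define A where "A = (if m = -1 then r else x (m + 1))"
    have "norm A \<le> (1 / 2) ^ k"
      \<comment> \<open>For m = -1 the neighbour is the prescribed value r; then k = 0 and norm r
        \<le> 1 is what is required.\<close>
      unfolding A_def using r m x(2) [of "m + 1"] by (cases "m = -1") auto
    moreover have "norm (x (m - 1)) \<le> (1 / 2) ^ k"
      using m by (intro x(2)) auto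
    moreover have "0 \<le> (1 / 2 :: real) ^ k" by simp
    moreover have "norm (left_map d r x m) \<le> (norm A + norm (x (m - 1))) / 250"
      unfolding A_def by (rule left_map_bound [OF d r(1) x(1)])
    moreover have "h \<le> q / 2" if "a \<le> q" "b \<le> q" "0 \<le> q" "h \<le> (a + b) / 250" for a b h q :: real
    proof -
      have "250 * h \<le> a + b" using that by simp
      then show ?thesis using that(1-3) by simp
    qed
    ultimately have "norm (left_map d r x m) \<le> (1 / 2) ^ k / 2" by blast
    then show ?thesis by simp
  qed
  have "norm (front_map d s (deviation d s) n) \<le> (1 / 2) ^ Suc k"
    unfolding front_map_def
    using Suc.prems one [OF s'(1) s(2), of n "deviation d s"] one [OF s'(2) s(3), of "- n" "\<lambda>k. deviation d s (- k)"]
      deviation_le [OF d s(1)] Suc.IH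
    by auto
  then show ?case by (simp add: front_map_deviation [OF d s(1)])
qed

lemma front_decay:
  assumes "s \<in> params d" "int k \<le> \<bar>n\<bar>"
  shows "n < 0 \<Longrightarrow> \<bar>front d s n\<bar> \<le> (1 / 2) ^ k" and "n > 0 \<Longrightarrow> \<bar>front d s n - 1\<bar> \<le> (1 / 2) ^ k"
proof -
  have s: "0 < s" "s < 1" using assms d by (auto simp: params_def)
  have "norm (complex_of_real s) \<le> 1" "norm (1 - complex_of_real s) \<le> 1"
    using s norm_of_real [of "1 - s", where 'a = complex] by simp_all
  then have dec: "norm (deviation d (of_real s) n) \<le> (1 / 2) ^ k"
    by (intro deviation_decay params_imp_good assms)
  show "n < 0 \<Longrightarrow> \<bar>front d s n\<bar> \<le> (1 / 2) ^ k"
    using dec profile_of_real [OF assms(1), of n] by (simp add: profile_def)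
  show "\<bar>front d s n - 1\<bar> \<le> (1 / 2) ^ k" if "n > 0"
  proof -
    have "deviation d (of_real s) n = 1 - profile d n (of_real s)"
      using that by (simp add: profile_def)
    also have "\<dots> = of_real (1 - front d s n)"
      using profile_of_real [OF assms(1), of n] by simp
    finally have "deviation d (of_real s) n = of_real (1 - front d s n)" .
    then show ?thesis using dec by (simp only: norm_of_real abs_minus_commute)
  qed
qed

lemma front_limits:
  assumes "s \<in> params d"
  shows "(front d s \<longlongrightarrow> 0) at_bot" "(front d s \<longlongrightarrow> 1) at_top"
proof -
  have k: "\<exists>k. (1 / 2 :: real) ^ k < e" if "e > 0" for e
    using real_arch_pow_inv [OF that, of "1 / 2"] by auto
  show "(front d s \<longlongrightarrow> 0) at_bot"
  proof (rule tendstoI)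
    fix e :: real assume "e > 0"
    then obtain k where k: "(1 / 2 :: real) ^ k < e" using k by blast
    have "dist (front d s n) 0 < e" if "n \<le> - int (Suc k)" for n
      using front_decay(1) [OF assms, of k n] that k by auto
    then show "\<forall>\<^sub>F n in at_bot. dist (front d s n) 0 < e"
      unfolding eventually_at_bot_linorder by blast
  qed
  show "(front d s \<longlongrightarrow> 1) at_top"
  proof (rule tendstoI)
    fix e :: real assume "e > 0"
    then obtain k where k: "(1 / 2 :: real) ^ k < e" using k by blast
    have "dist (front d s n) 1 < e" if "n \<ge> int (Suc k)" for n
      using front_decay(2) [OF assms, of k n] that k by (auto simp: dist_norm)
    then show "\<forall>\<^sub>F n in at_top. dist (front d s n) 1 < e"
      unfolding eventually_at_top_linorder by blast
  qed
qed

text \<open>\<open>\<phi>\<close> is a holomorphic extension of the reparameterization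
  \<open>\<sigma>\<close>; the affine map of the loop and the arctangent of the charts are the cases
  used later.\<close>

lemma smooth_on_front_mu:
  assumes "\<phi> holomorphic_on M" "open M" "of_real ` I \<subseteq> M"
    and "\<And>t. t \<in> I \<Longrightarrow> \<phi> (of_real t) = of_real (\<sigma> t)" "\<And>t. t \<in> I \<Longrightarrow> \<sigma> t \<in> params d"
  shows "smooth_on I (\<lambda>t. (front d (\<sigma> t), mu d (\<sigma> t)))"
proof (rule smooth_on_Pair)
  let ?N = "{z \<in> M. \<phi> z \<in> good d}"
  have N: "of_real ` I \<subseteq> ?N"
    using assms params_imp_good by (auto simp: subset_iff)
  have "smooth_on I (trace (\<lambda>n z. profile d n (\<phi> z)))"
    by (intro smooth_on_trace [OF _ N] holo_family_compose holo_family_profile assms)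
  then show "smooth_on I (\<lambda>t. front d (\<sigma> t))"
    unfolding smooth_on_def front_def using assms(4) by (auto simp: trace_def)
  have mu_of: "(\<lambda>s. mu_of d s (deviation d s)) holomorphic_on good d"
    by (intro holomorphic_mu_of holomorphic_deviation d holomorphic_intros) (auto simp: good_def left_good_def)
  \<comment> \<open>To treat the scalar \<mu> as a family, it is repeated at every index and
    afterwards read off at index 0.\<close>
  have "holo_family UNIV (\<lambda>_ :: int. \<lambda>z. z)"
    unfolding holo_family_def
  proof (intro conjI ballI allI)
    fix z :: complex
    have "norm w \<le> norm z + 1" if "w \<in> ball z 1" for w
      using that norm_triangle_sub [of w z] by (simp add: dist_norm norm_minus_commute)
    then show "\<exists>r>0. \<exists>B. ball z r \<subseteq> UNIV \<and> (\<forall>n :: int. \<forall>w\<in>ball z r. norm w \<le> B)"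
      by (meson subset_UNIV zero_less_one)
  qed (auto intro: holomorphic_intros)
  from holo_family_compose [OF this mu_of open_good]
  have "holo_family (good d) (\<lambda>_. \<lambda>s. mu_of d s (deviation d s))" by simp
  from holo_family_compose [OF this assms(1,2)]
  have hf: "holo_family ?N (\<lambda>_. \<lambda>z. mu_of d (\<phi> z) (deviation d (\<phi> z)))" .
  have "smooth_on I (\<lambda>t. trace (\<lambda>_. \<lambda>z. mu_of d (\<phi> z) (deviation d (\<phi> z))) t 0)"
    by (intro smooth_on_bounded_linear [OF bounded_linear_apply] smooth_on_trace [OF hf N])
  moreover have "trace (\<lambda>_. \<lambda>z. mu_of d (\<phi> z) (deviation d (\<phi> z))) t 0 = mu d (\<sigma> t)" if "t \<in> I" for t
    using that N assms(4) by (subst trace_apply [OF hf]) (auto simp: mu_def)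
  ultimately show "smooth_on I (\<lambda>t. mu d (\<sigma> t))"
    unfolding smooth_on_def by auto
qed

end

section \<open>The curve of shifted fronts\<close>

definition arc :: "real \<Rightarrow> int \<Rightarrow> real \<Rightarrow> linf \<times> real" where
  "arc d p s = (shift p (front d s), mu d s)"

definition front_curve :: "real \<Rightarrow> (linf \<times> real) set" where
  "front_curve d = (\<Union>p. arc d p ` params d)"

lemma nagumo_steady_shift:
  assumes "nagumo_steady d U \<mu>"
  shows "nagumo_steady d (shift p U) \<mu>"
  unfolding nagumo_steady_def
proof
  fix n
  show "0 = d * (shift p U (n + 1) + shift p U (n - 1) - 2 * shift p U n)
      + shift p U n * (shift p U n - \<mu>) * (1 - shift p U n)"
    using assms [unfolded nagumo_steady_def, rule_format, of "n + p"] by (simp add: algebra_simps)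
qed

lemma shift_proj_eq_iff:
  "shift_proj (U, \<mu>) = shift_proj (V, \<nu>) \<longleftrightarrow> (\<exists>p. shift p U = V) \<and> \<mu> = \<nu>"
  using eq_equiv_class_iff [OF equiv_shift_rel, of U V]
  by (auto simp: shift_proj_def shift_rel_def)

lemma connected_chain_UN:
  fixes A :: "int \<Rightarrow> 'a :: topological_space set"
  assumes conn: "\<And>p. connected (A p)" and meet: "\<And>p. A p \<inter> A (p + 1) \<noteq> {}"
  shows "connected (\<Union>p. A p)"
proof -
  let ?P = "\<lambda>p C. connected C \<and> A 0 \<subseteq> C \<and> A p \<subseteq> C \<and> C \<subseteq> (\<Union>p. A p)"
  have "\<exists>C. ?P p C" for p
  proof (induction p rule: int_induct [of _ 0])
    case base
    show ?case using conn by (intro exI [of _ "A 0"]) auto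
  next
    case (step1 i)
    then obtain C where C: "?P i C" by blast
    moreover have "connected (C \<union> A (i + 1))"
      using C meet [of i] by (intro connected_Un conn) auto
    ultimately show ?case by (intro exI [of _ "C \<union> A (i + 1)"]) auto
  next
    case (step2 i)
    then obtain C where C: "?P i C" by blast
    moreover have "connected (C \<union> A (i - 1))"
      using C meet [of "i - 1"] by (intro connected_Un conn) auto
    ultimately show ?case by (intro exI [of _ "C \<union> A (i - 1)"]) auto
  qed
  then obtain C where C: "\<And>p. ?P p (C p)" by metis
  obtain a where a: "a \<in> A 0" using meet [of 0] by auto
  have "connected (\<Union>p. C p)"
  proof (rule connected_Union)
    have "a \<in> (\<Inter>p. C p)" using C a by blast
    then show "(\<Inter>p. C p) \<noteq> {}" by blast
  qed (use C in auto)
  moreover have "(\<Union>p. C p) = (\<Union>p. A p)"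
    using C by blast
  ultimately show ?thesis by simp
qed

text \<open>Division of an estimate by a factor k that is known only up to O(d): an upper bound k'
  of k suffices for a lower bound on b. The companion below uses a lower bound of k for an upper
  bound on b.\<close>

lemma less_if_le_mult:
  fixes b :: real
  assumes "c \<le> b * k" "0 \<le> k" "k \<le> k'" "0 \<le> x" "x * k' < c"
  shows "x < b"
proof (rule ccontr)
  assume "\<not> x < b"
  then have "b * k \<le> x * k" using assms by (intro mult_right_mono) auto
  also have "\<dots> \<le> x * k'" using assms by (intro mult_left_mono) auto
  finally show False using assms by simp
qed

lemma less_if_mult_le:
  fixes b :: real
  assumes "b * k \<le> c" "0 \<le> k'" "k' \<le> k" "0 \<le> x" "c < x * k'"
  shows "b < x"
proof (rule ccontr)
  assume "\<not> b < x"
  then have "x * k' \<le> b * k" using assms by (intro mult_mono) auto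
  then show False using assms by simp
qed

context
  fixes d :: real
  assumes d: "0 < d" "d < 1 / 10 ^ 6"
begin

lemma smooth_on_arc:
  assumes "\<phi> holomorphic_on M" "open M" "of_real ` I \<subseteq> M"
    and "\<And>t. t \<in> I \<Longrightarrow> \<phi> (of_real t) = of_real (\<sigma> t)" "\<And>t. t \<in> I \<Longrightarrow> \<sigma> t \<in> params d"
  shows "smooth_on I (\<lambda>t. arc d p (\<sigma> t))"
proof -
  have "bounded_linear (\<lambda>x :: linf \<times> real. (shift p (fst x), snd x))"
    by (intro bounded_linear_Pair bounded_linear_compose [OF bounded_linear_shift]
        bounded_linear_fst bounded_linear_snd)
  from smooth_on_bounded_linear [OF this smooth_on_front_mu [OF d assms]]
  show ?thesis by (simp add: arc_def)
qed

lemma smooth_on_arc_id: "smooth_on (params d) (arc d p)"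
  using smooth_on_arc [of "\<lambda>z. z" UNIV "params d" "\<lambda>t. t" p]
  by (simp add: holomorphic_on_ident)

lemma continuous_on_front: "continuous_on (params d) (\<lambda>s. front d s n)"
proof -
  have "continuous_on (params d) (\<lambda>s. fst (arc d 0 s))"
    by (intro continuous_on_fst smooth_on_imp_continuous_on smooth_on_arc_id)
  then show ?thesis
    using bounded_linear.continuous_on [OF bounded_linear_apply, of "params d" "\<lambda>s. fst (arc d 0 s)" n]
    by (simp add: arc_def)
qed

section \<open>Gluing the arc of fronts to its translates\<close>

text \<open>The shift moves U_0 = s to site -1, so s \<le> 12 d keeps the sequence in the ball of
  the contraction, and \<open>front_unique\<close> identifies it as the front with parameter
  U_1.\<close>

lemma shift_front_right:
  assumes "s \<in> params d" "front d s 1 \<in> params d" "s \<le> 12 * d"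
  shows "shift 1 (front d s) = front d (front d s 1)" "mu d s = mu d (front d s 1)"
proof -
  have s: "0 < s" using assms d by (auto simp: params_def)
  let ?U = "shift 1 (front d s)"
  have 1: "nagumo_steady d ?U (mu d s)"
    by (intro nagumo_steady_shift front_steady d assms)
  have 2: "?U 0 \<in> params d" using assms by simp
  have 3: "\<bar>?U n\<bar> \<le> 12 * d" if "n < 0" for n
    using that assms s d front_neg [OF d assms(1), of "n + 1"] by (cases "n = -1") auto
  have 4: "\<bar>1 - ?U n\<bar> \<le> 12 * d" if "0 < n" for n
    using that front_pos [OF d assms(1), of "n + 1"] by simp
  show "?U = front d (front d s 1)"
    using front_unique(1) [OF d 1 2 3 4] by simp
  show "mu d s = mu d (front d s 1)"
    using front_unique(2) [OF d 1 2 3 4] by simp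
qed

lemma shift_front_left:
  assumes "s \<in> params d" "front d s (-1) \<in> params d" "1 - s \<le> 12 * d"
  shows "shift (-1) (front d s) = front d (front d s (-1))" "mu d s = mu d (front d s (-1))"
proof -
  have s: "s < 1" using assms d by (auto simp: params_def)
  let ?U = "shift (-1) (front d s)"
  have 1: "nagumo_steady d ?U (mu d s)"
    by (intro nagumo_steady_shift front_steady d assms)
  have 2: "?U 0 \<in> params d" using assms by simp
  have 3: "\<bar>?U n\<bar> \<le> 12 * d" if "n < 0" for n
    using that front_neg [OF d assms(1), of "n - 1"] by simp
  have 4: "\<bar>1 - ?U n\<bar> \<le> 12 * d" if "0 < n" for n
    using that assms s d front_pos [OF d assms(1), of "n - 1"] by (cases "n = 1") auto
  show "?U = front d (front d s (-1))"
    using front_unique(1) [OF d 1 2 3 4] by simp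
  show "mu d s = mu d (front d s (-1))"
    using front_unique(2) [OF d 1 2 3 4] by simp
qed

text \<open>Three coordinates suffice to separate the arc of fronts from all of its other translates.\<close>

lemma shifted_front_in_chart:
  fixes r :: int
  defines "V \<equiv> \<lambda>s r. shift r (front d s)"
  assumes s: "s \<in> params d" and V: "V s r 0 \<in> params d" "V s r (-1) < 12 * d" "1 - 12 * d < V s r 1"
  shows "V s r = front d (V s r 0)" "mu d s = mu d (V s r 0)"
proof -
  \<comment> \<open>For |r| \<ge> 2 one of the sites -1, 1 shows a value close to the wrong limit
    state. For r = 1 and r = -1 the window conditions say that s is within 12 d of 0 or 1, so the
    gluing lemmas apply.\<close>
  consider "r \<le> -2" | "r = -1" | "r = 0" | "r = 1" | "r \<ge> 2" by linarith
  then have "V s r = front d (V s r 0) \<and> mu d s = mu d (V s r 0)"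
  proof cases
    case 1
    then show ?thesis using front_neg [OF d s, of "1 + r"] V d by (auto simp: V_def)
  next
    case 2
    then show ?thesis using shift_front_left [OF s] V s d by (auto simp: V_def)
  next
    case 3
    then show ?thesis using s d by (auto simp: V_def)
  next
    case 4
    then show ?thesis using shift_front_right [OF s] V s d by (auto simp: V_def)
  next
    case 5
    then show ?thesis using front_pos [OF d s, of "r - 1"] V d by (auto simp: V_def)
  qed
  then show "V s r = front d (V s r 0)" "mu d s = mu d (V s r 0)" by auto
qed

text \<open>Applied to the equation at the neighbours of site \<open>0\<close>: it gives \<open>1 - U\<^sub>1 \<approx> d / (1 - \<mu>)\<close> for
  small \<open>s\<close> and \<open>U\<^sub>-\<^sub>1 \<approx> d / \<mu>\<close> for \<open>s\<close> close to \<open>1\<close>.\<close>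

lemma neighbour_estimate:
  fixes b c e \<nu> :: real
  assumes "b * (1 - b) * (\<nu> - b) = d * (e + c - 2 * b)"
    and "\<bar>e - 1\<bar> \<le> 12 * d" "\<bar>c\<bar> \<le> 12 * d" "\<bar>b\<bar> \<le> 12 * d" "0 \<le> \<nu>" "\<nu> \<le> 1"
  shows "\<bar>b * \<nu> - d\<bar> \<le> 400 * d\<^sup>2"
proof -
  have "b * \<nu> - d = b * (1 - b) * (\<nu> - b) - d + b * b * (1 + \<nu> - b)"
    by (simp add: algebra_simps)
  also have "\<dots> = d * ((e - 1) + c - 2 * b) + b * b * (1 + \<nu> - b)"
    unfolding assms(1) by (simp add: algebra_simps)
  finally have eq: "b * \<nu> - d = d * ((e - 1) + c - 2 * b) + b * b * (1 + \<nu> - b)" .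
  \<comment> \<open>The bracket is at most 12 d + 12 d + 24 d; together with 144 * 21/10 from the
    quadratic term the constant stays below 400.\<close>
  have "\<bar>d * ((e - 1) + c - 2 * b)\<bar> \<le> d * (48 * d)"
    unfolding abs_mult using d assms by (intro mult_mono) auto
  moreover have "\<bar>b * b * (1 + \<nu> - b)\<bar> \<le> (12 * d) * (12 * d) * (21 / 10)"
    unfolding abs_mult using d assms by (intro mult_mono) auto
  ultimately show ?thesis
    unfolding eq power2_eq_square using d by simp
qed

lemma front_right_estimate:
  assumes "s \<in> params d" "s \<le> 12 * d"
  shows "\<bar>(1 - front d s 1) * (1 - mu d s) - d\<bar> \<le> 400 * d\<^sup>2"
proof (rule neighbour_estimate)
  show "(1 - front d s 1) * (1 - (1 - front d s 1)) * (1 - mu d s - (1 - front d s 1))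
      = d * ((1 - s) + (1 - front d s 2) - 2 * (1 - front d s 1))"
    using front_steady [OF d assms(1), unfolded nagumo_steady_def, rule_format, of 1] assms d
    by (simp add: algebra_simps)
  show "\<bar>1 - s - 1\<bar> \<le> 12 * d" using assms d by (auto simp: params_def)
qed (use front_pos [OF d assms(1), of 1] front_pos [OF d assms(1), of 2] mu_bounds [OF d assms(1)] in auto)

lemma front_left_estimate:
  assumes "s \<in> params d" "1 - s \<le> 12 * d"
  shows "\<bar>front d s (-1) * mu d s - d\<bar> \<le> 400 * d\<^sup>2"
proof (rule neighbour_estimate)
  show "front d s (-1) * (1 - front d s (-1)) * (mu d s - front d s (-1))
      = d * (s + front d s (-2) - 2 * front d s (-1))"
    using front_steady [OF d assms(1), unfolded nagumo_steady_def, rule_format, of "-1"] assms d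
    by (simp add: algebra_simps)
  show "\<bar>s - 1\<bar> \<le> 12 * d" using assms d by (auto simp: params_def)
qed (use front_neg [OF d assms(1), of "-1"] front_neg [OF d assms(1), of "-2"] mu_bounds [OF d assms(1)] in auto)

lemma mu_estimate_left:
  assumes "s \<in> params d" "s \<le> 12 * d"
  shows "\<bar>mu d s - d / s\<bar> \<le> 40 * d"
proof -
  have "d * (1 / (1 - s)) \<le> d * 2"
    using d assms by (intro mult_left_mono) (auto simp: field_simps)
  then have "d / (1 - s) \<le> d * 2" by simp
  moreover have "0 \<le> d / (1 - s)" "0 \<le> s"
    using d assms by (auto simp: params_def)
  ultimately show ?thesis
    using mu_near_lead_mu [OF d assms(1)] assms(2) d(1) unfolding lead_mu_def by linarith
qed

lemma mu_estimate_right: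
  assumes "s \<in> params d" "1 - s \<le> 12 * d"
  shows "\<bar>mu d s - (1 - d / (1 - s))\<bar> \<le> 40 * d"
proof -
  have "d * (1 / s) \<le> d * 2"
    using d assms by (intro mult_left_mono) (auto simp: field_simps)
  then have "d / s \<le> d * 2" by simp
  moreover have "0 \<le> d / s" "s \<le> 1"
    using d assms by (auto simp: params_def)
  ultimately show ?thesis
    using mu_near_lead_mu [OF d assms(1)] assms(2) d(1) unfolding lead_mu_def by linarith
qed

lemma d_square: "400 * d\<^sup>2 \<le> d / 1000"
  using d by (simp add: power2_eq_square)

text \<open>With \<mu> about d/s, the transition to the next translate is 1 - U_1 about d/(1 - d/s).
  Here c is a numerical lower bound for d/s, and 999/1000 absorbs the error 400 d^2.\<close>

lemma front_right_lower:
  assumes "s \<in> params d" "s \<le> 12 * d" "c \<le> d / s" "c < 1"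
  shows "d * (999 / 1000) \<le> (1 - front d s 1) * (1 - c + 40 * d)"
proof -
  have e: "d * (999 / 1000) \<le> (1 - front d s 1) * (1 - mu d s)"
    using front_right_estimate [OF assms(1,2)] d_square by linarith
  have "0 < (1 - front d s 1) * (1 - mu d s)"
    using d by (intro less_le_trans [OF _ e]) simp
  then have "0 < 1 - front d s 1"
    using mu_bounds [OF d assms(1)] by (simp add: zero_less_mult_iff)
  then have "(1 - front d s 1) * (1 - mu d s) \<le> (1 - front d s 1) * (1 - c + 40 * d)"
    using mu_estimate_left [OF assms(1,2)] assms by (intro mult_left_mono) auto
  with e show ?thesis by linarith
qed

lemma front_right_upper:
  assumes "s \<in> params d" "s \<le> 12 * d" "d / s \<le> c"
  shows "(1 - front d s 1) * (1 - c - 40 * d) \<le> d * (1001 / 1000)"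
proof -
  have e: "(1 - front d s 1) * (1 - mu d s) \<le> d * (1001 / 1000)"
    and e': "d * (999 / 1000) \<le> (1 - front d s 1) * (1 - mu d s)"
    using front_right_estimate [OF assms(1,2)] d_square by linarith+
  have "0 < (1 - front d s 1) * (1 - mu d s)"
    using d by (intro less_le_trans [OF _ e']) simp
  then have "0 < 1 - front d s 1"
    using mu_bounds [OF d assms(1)] by (simp add: zero_less_mult_iff)
  then have "(1 - front d s 1) * (1 - c - 40 * d) \<le> (1 - front d s 1) * (1 - mu d s)"
    using mu_estimate_left [OF assms(1,2)] assms by (intro mult_left_mono) auto
  with e show ?thesis by linarith
qed

text \<open>Up to s = 5d/2 one has d/s \<ge> 2/5, hence 1 - U_1 is at least about 5d/3, which is
  still above the margin 3d/2.\<close>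

lemma front_right_in_params:
  assumes "s \<in> params d" "s \<le> 5 / 2 * d"
  shows "front d s 1 \<in> params d"
proof -
  have s: "0 < s" "s \<le> 12 * d" using assms d by (auto simp: params_def)
  have "2 / 5 \<le> d / s" using s assms by (simp add: field_simps)
  then have "d * (999 / 1000) \<le> (1 - front d s 1) * (1 - 2 / 5 + 40 * d)"
    by (intro front_right_lower assms s) auto
  then have "3 / 2 * d < 1 - front d s 1"
    by (rule less_if_le_mult [where k' = "61 / 100"]) (use d in auto)
  moreover have "\<bar>1 - front d s 1\<bar> < 12 * d"
    using front_pos [OF d assms(1), of 1] by simp
  ultimately show ?thesis using d unfolding params_def by simp
qed

section \<open>A fundamental domain for the shift\<close>

text \<open>At s = 2d one has \<mu> about 1/2 and 1 - U_1 about 2d. \<open>right_end\<close> is by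
  construction the parameter of the shifted front, so the two ends represent the same class.\<close>

definition left_end :: real where "left_end = 2 * d"
definition right_end :: real where "right_end = front d (2 * d) 1"

lemma left_end_params: "left_end \<in> params d"
  using d by (auto simp: params_def left_end_def)

lemma right_end_params: "right_end \<in> params d"
  unfolding right_end_def
  using left_end_params d by (intro front_right_in_params) (auto simp: left_end_def)

lemma right_end_bounds: "19 / 10 * d < 1 - right_end" "1 - right_end < 21 / 10 * d"
proof -
  have s: "2 * d \<in> params d" "2 * d \<le> 12 * d" "d / (2 * d) = 1 / 2"
    using left_end_params d by (auto simp: left_end_def)
  have 1: "d * (999 / 1000) \<le> (1 - right_end) * (1 - 1 / 2 + 40 * d)"
    unfolding right_end_def using s by (intro front_right_lower) auto
  then show "19 / 10 * d < 1 - right_end"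
    by (rule less_if_le_mult [where k' = "51 / 100"]) (use d in auto)
  have 2: "(1 - right_end) * (1 - 1 / 2 - 40 * d) \<le> d * (1001 / 1000)"
    unfolding right_end_def using s by (intro front_right_upper) auto
  then show "1 - right_end < 21 / 10 * d"
    by (rule less_if_mult_le [where k' = "49 / 100"]) (use d in auto)
qed

lemma right_end_less:
  assumes "s \<in> params d" "5 / 2 * d \<le> s" "s \<le> 12 * d"
  shows "right_end < front d s 1"
proof -
  have "0 < s" using assms d by (auto simp: params_def)
  then have "d / s \<le> 2 / 5" using assms by (simp add: field_simps)
  then have "(1 - front d s 1) * (1 - 2 / 5 - 40 * d) \<le> d * (1001 / 1000)"
    by (intro front_right_upper assms)
  then have "1 - front d s 1 < 19 / 10 * d"
    by (rule less_if_mult_le [where k' = "59 / 100"]) (use d in auto)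
  then show ?thesis using right_end_bounds by simp
qed

text \<open>U_1 determines the whole shifted front, and site -1 of that front is s again. No
  derivative of s |-> U_1 has to be estimated.\<close>

lemma front_right_inj:
  assumes "a \<in> params d"
  shows "inj_on (\<lambda>s. front d s 1) {a..5 / 2 * d}"
proof (rule inj_onI)
  fix s t assume s: "s \<in> {a..5 / 2 * d}" and t: "t \<in> {a..5 / 2 * d}" and eq: "front d s 1 = front d t 1"
  have params: "s \<in> params d" "t \<in> params d" "s \<le> 12 * d" "t \<le> 12 * d"
    using s t assms d by (auto simp: params_def)
  have "shift 1 (front d s) = shift 1 (front d t)"
    using shift_front_right(1) [of s] shift_front_right(1) [of t] params s t front_right_in_params eq by auto
  then have "shift 1 (front d s) (-1) = shift 1 (front d t) (-1)" by simp
  then show "s = t" using params d by simp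
qed

text \<open>Continuity and injectivity give strict monotonicity. Its direction is settled by the
  comparison point 5d/2, far enough from 2d for the coarse estimate
  \<open>right_end_less\<close>.\<close>

lemma front_right_mono:
  assumes "a \<in> params d" "a < x" "x < 5 / 2 * d"
  shows "front d a 1 < front d x 1 \<and> front d x 1 < front d (5 / 2 * d) 1 \<or>
    front d (5 / 2 * d) 1 < front d x 1 \<and> front d x 1 < front d a 1"
proof -
  have "{a..5 / 2 * d} \<subseteq> params d" using assms d by (auto simp: params_def)
  then have "continuous_on {a..5 / 2 * d} (\<lambda>s. front d s 1)"
    using continuous_on_front continuous_on_subset by blast
  from continuous_inj_imp_mono [OF assms(2,3) this front_right_inj [OF assms(1)]]
  show ?thesis by auto
qed

lemma less_right_end:
  assumes "s \<in> params d" "s < left_end"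
  shows "front d s 1 < right_end"
proof -
  have "right_end < front d (5 / 2 * d) 1"
    by (rule right_end_less) (use d in \<open>auto simp: params_def\<close>)
  then show ?thesis
    using front_right_mono [of s left_end] assms d by (auto simp: left_end_def right_end_def)
qed

lemma right_end_le:
  assumes "left_end \<le> s" "s \<le> 12 * d"
  shows "right_end \<le> front d s 1"
proof -
  have s: "s \<in> params d" using assms d by (auto simp: params_def left_end_def)
  have r: "right_end < front d (5 / 2 * d) 1"
    by (rule right_end_less) (use d in \<open>auto simp: params_def\<close>)
  consider "s = left_end" | "left_end < s" "s < 5 / 2 * d" | "5 / 2 * d \<le> s"
    using assms by linarith
  then show ?thesis
  proof cases
    case 1
    then show ?thesis by (simp add: left_end_def right_end_def)
  next
    case 2
    then show ?thesis
      using front_right_mono [OF left_end_params 2] r by (auto simp: left_end_def right_end_def)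
  next
    case 3
    then show ?thesis using right_end_less [OF s] assms by simp
  qed
qed

lemma front_left_bounds:
  assumes "s \<in> params d" "right_end \<le> s"
  shows "front d s (-1) \<in> params d" "front d s (-1) \<le> 12 * d"
proof -
  have s: "0 < 1 - s" "1 - s \<le> 12 * d" "1 - s \<le> 21 / 10 * d"
    using assms right_end_bounds d by (auto simp: params_def)
  have "10 / 21 \<le> d / (1 - s)" using s by (simp add: field_simps)
  then have m: "mu d s \<le> 53 / 100"
    using mu_estimate_right [OF assms(1) s(2)] d by auto
  have e: "d * (999 / 1000) \<le> front d s (-1) * mu d s"
    using front_left_estimate [OF assms(1) s(2)] d_square by linarith
  then have "3 / 2 * d < front d s (-1)"
    by (rule less_if_le_mult [where k' = "53 / 100"]) (use d m mu_bounds [OF d assms(1)] in auto)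
  moreover have "\<bar>front d s (-1)\<bar> < 12 * d"
    using front_neg [OF d assms(1), of "-1"] by simp
  ultimately show "front d s (-1) \<in> params d" "front d s (-1) \<le> 12 * d"
    using d unfolding params_def by auto
qed

lemma params_reduce:
  assumes "s \<in> params d"
  shows "\<exists>t\<in>{left_end..right_end}. shift_proj (front d s, mu d s) = shift_proj (front d t, mu d t)"
proof -
  consider "s < left_end" | "s \<in> {left_end..right_end}" | "right_end < s" by fastforce
  then show ?thesis
  proof cases
    case 1
    let ?t = "front d s 1"
    have t: "?t \<in> params d" "s \<le> 12 * d"
      using 1 d assms by (auto intro!: front_right_in_params simp: left_end_def)
    have "?t \<le> right_end" using less_right_end [OF assms 1] by simp
    moreover have "left_end \<le> ?t"
      using front_pos [OF d assms, of 1] d by (auto simp: left_end_def)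
    ultimately show ?thesis
      using shift_front_right [OF assms t]
      by (intro bexI [of _ ?t]) (auto simp: shift_proj_eq_iff)
  next
    case 2
    then show ?thesis by blast
  next
    case 3
    let ?t = "front d s (-1)"
    have t: "?t \<in> params d" "?t \<le> 12 * d"
      using front_left_bounds [OF assms] 3 by auto
    have "1 - s \<le> 12 * d" using 3 right_end_bounds d by simp
    note sh = shift_front_left [OF assms t(1) this]
    \<comment> \<open>If t were left of \<open>left_end\<close>, monotonicity would put its U_1
      below \<open>right_end\<close>; but this U_1 is s itself.\<close>
    have "front d ?t 1 = shift (-1) (front d s) 1" using sh(1) by simp
    also have "\<dots> = s" using assms d by simp
    finally have "front d ?t 1 = s" .
    then have "left_end \<le> ?t"
      using less_right_end [OF t(1)] 3 by fastforce
    moreover have "?t \<le> right_end"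
      using t(2) right_end_bounds d by simp
    ultimately show ?thesis
      using sh by (intro bexI [of _ ?t]) (auto simp: shift_proj_eq_iff)
  qed
qed

lemma ends_subset_params: "{left_end..right_end} \<subseteq> params d"
  using left_end_params right_end_params by (auto simp: params_def)

text \<open>For r \<ge> 2 site -1 of the shifted front is close to 1, whereas a front is small
  there. For r = 1 that site equals s, so s is small and U_1 is at least \<open>right_end\<close>;
  yet U_1 would be t, which is excluded only because the interval is half-open.\<close>

lemma shift_front_neq:
  assumes "s \<in> {left_end..<right_end}" "t \<in> {left_end..<right_end}" "1 \<le> r"
  shows "shift r (front d s) \<noteq> front d t"
proof
  assume eq: "shift r (front d s) = front d t"
  have st: "s \<in> params d" "t \<in> params d" using assms ends_subset_params by (auto simp: subset_iff)
  have neg: "front d s (r - 1) < 12 * d"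
    using arg_cong [OF eq, of "\<lambda>U. apply_bcontfun U (-1)"] front_neg [OF d st(2), of "-1"] by simp
  show False
  proof (cases "r = 1")
    case True
    then have "right_end \<le> front d s 1"
      using neg st d assms by (intro right_end_le) auto
    moreover have "front d s 1 = t"
      using arg_cong [OF eq, of "\<lambda>U. apply_bcontfun U 0"] True st d by simp
    ultimately show False using assms by simp
  next
    case False
    then show False
      using neg front_pos [OF d st(1), of "r - 1"] assms(3) d by simp
  qed
qed

lemma front_class_inj:
  assumes "s \<in> {left_end..<right_end}" "t \<in> {left_end..<right_end}"
    and "shift_proj (front d s, mu d s) = shift_proj (front d t, mu d t)"
  shows "s = t"
proof -
  have st: "s \<in> params d" "t \<in> params d" using assms ends_subset_params by (auto simp: subset_iff)
  obtain r where r: "shift r (front d s) = front d t"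
    using assms(3) by (auto simp: shift_proj_eq_iff)
  then have r': "shift (- r) (front d t) = front d s"
    by (simp add: r [symmetric] shift_add [symmetric])
  have "r = 0"
    using shift_front_neq [OF assms(1,2), of r] shift_front_neq [OF assms(2,1), of "- r"] r r' by force
  then have "front d s 0 = front d t 0" using r by simp
  then show ?thesis using st d by simp
qed

lemma closed_loop_front_curve: "closed_loop (shift_proj ` front_curve d)"
proof -
  define \<sigma> where "\<sigma> t = left_end + t * (right_end - left_end)" for t
  have lr: "left_end < right_end"
    using right_end_bounds d by (simp add: left_end_def)
  have \<sigma>: "\<sigma> t \<in> {left_end..right_end}" if "t \<in> {0..1}" for t
  proof -
    have "t * (right_end - left_end) \<le> right_end - left_end" "0 \<le> t * (right_end - left_end)"
      using that lr by (auto intro: mult_left_le_one_le)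
    then show ?thesis by (simp add: \<sigma>_def)
  qed
  have \<sigma>_less: "\<sigma> t < right_end" if "t < 1" for t
  proof -
    have "(1 - t) * (right_end - left_end) > 0" using that lr by simp
    then show ?thesis by (simp add: \<sigma>_def algebra_simps)
  qed
  have smooth: "smooth_on {0..1} (\<lambda>t. arc d 0 (\<sigma> t))"
  proof (rule smooth_on_arc [of "\<lambda>z. of_real left_end + z * of_real (right_end - left_end)" UNIV])
    show "(\<lambda>z. of_real left_end + z * of_real (right_end - left_end)) holomorphic_on UNIV"
      by (intro holomorphic_intros)
  qed (use \<sigma> ends_subset_params in \<open>auto simp: \<sigma>_def subset_iff\<close>)
  let ?\<gamma> = "\<lambda>t. shift_proj (arc d 0 (\<sigma> t))"
  have arc0: "arc d 0 s = (front d s, mu d s)" for s by (simp add: arc_def)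
  show ?thesis
    unfolding closed_loop_def
  proof (intro exI [of _ ?\<gamma>] conjI)
    show "smooth_mod_shift {0..1} ?\<gamma>"
      unfolding smooth_mod_shift_def
    proof
      fix s :: real assume "s \<in> {0..1}"
      \<comment> \<open>The parameterization has one smooth lift on all of [0,1], so its
        restrictions serve as the local lifts.\<close>
      have "smooth_on ({0..1} \<inter> ball s 1) (\<lambda>t. arc d 0 (\<sigma> t))"
        by (rule smooth_on_subset [OF smooth]) auto
      then show "\<exists>e>0. \<exists>g. smooth_on ({0..1} \<inter> ball s e) g \<and>
          (\<forall>t\<in>{0..1} \<inter> ball s e. ?\<gamma> t = shift_proj (g t))"
        by (intro exI [of _ 1] exI [of _ "\<lambda>t. arc d 0 (\<sigma> t)"]) auto
    qed
    show "?\<gamma> ` {0..1} = shift_proj ` front_curve d"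
    proof (intro equalityI subsetI)
      fix y assume "y \<in> ?\<gamma> ` {0..1}"
      then obtain t where "t \<in> {0..1}" "y = ?\<gamma> t" by blast
      then show "y \<in> shift_proj ` front_curve d"
        using \<sigma> [of t] ends_subset_params unfolding front_curve_def by blast
    next
      fix y assume "y \<in> shift_proj ` front_curve d"
      then obtain p s where s: "s \<in> params d" and y: "y = shift_proj (arc d p s)"
        by (auto simp: front_curve_def)
      obtain t where t: "t \<in> {left_end..right_end}"
          and st: "shift_proj (front d s, mu d s) = shift_proj (front d t, mu d t)"
        using params_reduce [OF s] by blast
      define u where "u = (t - left_end) / (right_end - left_end)"
      have u: "u \<in> {0..1}" "\<sigma> u = t"
        using t lr by (auto simp: u_def \<sigma>_def field_simps)
      have "shift_proj (front d s, mu d s) = y"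
        by (auto simp: y arc_def shift_proj_eq_iff)
      then have "y = ?\<gamma> u" using st u by (simp add: arc0)
      then show "y \<in> ?\<gamma> ` {0..1}" using u by blast
    qed
    show "inj_on ?\<gamma> {0..<1}"
    proof (rule inj_onI)
      fix t u :: real assume tu: "t \<in> {0..<1}" "u \<in> {0..<1}" and eq: "?\<gamma> t = ?\<gamma> u"
      have "\<sigma> t = \<sigma> u"
        using \<sigma> [of t] \<sigma> [of u] \<sigma>_less [of t] \<sigma>_less [of u] tu eq
        by (intro front_class_inj) (auto simp: arc0)
      then show "t = u" using lr by (simp add: \<sigma>_def)
    qed
    have "shift 1 (front d left_end) = front d right_end" "mu d left_end = mu d right_end"
      using shift_front_right [of left_end] left_end_params right_end_params d
      by (auto simp: left_end_def right_end_def)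
    then show "?\<gamma> 0 = ?\<gamma> 1"
      by (auto simp: arc0 \<sigma>_def shift_proj_eq_iff)
  qed
qed

section \<open>The union of the arcs as an embedded curve\<close>

text \<open>Arc p at \<open>right_end\<close> and arc p + 1 at \<open>left_end\<close> are the same
  point, so the arcs form a chain indexed by the integers.\<close>

lemma connected_front_curve: "connected (front_curve d)"
  unfolding front_curve_def
proof (rule connected_chain_UN)
  fix p
  have "connected (params d)" by (simp add: params_def)
  then show "connected (arc d p ` params d)"
    by (intro connected_continuous_image smooth_on_imp_continuous_on smooth_on_arc_id)
  have "shift 1 (front d left_end) = front d right_end" "mu d left_end = mu d right_end"
    using shift_front_right [of left_end] left_end_params right_end_params d
    by (auto simp: left_end_def right_end_def)
  then have "arc d (p + 1) left_end = arc d p right_end"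
    by (simp add: arc_def shift_add)
  then show "arc d p ` params d \<inter> arc d (p + 1) ` params d \<noteq> {}"
    using left_end_params right_end_params by blast
qed

text \<open>Sites -p - 1, -p and 1 - p of a sequence shifted by p are the sites -1, 0 and 1 of the
  original front.\<close>

definition window :: "int \<Rightarrow> (linf \<times> real) set" where
  "window p = {x :: linf \<times> real. apply_bcontfun (fst x) (- p) \<in> params d \<and> apply_bcontfun (fst x) (- p - 1) < 12 * d
     \<and> 1 - 12 * d < apply_bcontfun (fst x) (1 - p)}"

lemma chart_image:
  "front_curve d \<inter> window p = arc d p ` params d"
proof (intro equalityI subsetI)
  fix x assume x: "x \<in> front_curve d \<inter> window p"
  then obtain q s where s: "s \<in> params d" and xq: "x = arc d q s" by (auto simp: front_curve_def)
  define V where "V = shift (q - p) (front d s)"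
  have V0: "V 0 \<in> params d" "V (-1) < 12 * d" "1 - 12 * d < V 1"
    using x by (simp_all add: xq arc_def V_def window_def algebra_simps)
  note V = shifted_front_in_chart [OF s, of "q - p", folded V_def, OF V0]
  have "shift q (front d s) = shift p V"
    by (simp add: V_def flip: shift_add)
  also have "\<dots> = shift p (front d (V 0))" using V(1) by simp
  finally have "x = arc d p (V 0)" using V(2) by (simp add: xq arc_def)
  then show "x \<in> arc d p ` params d" using V0(1) by blast
next
  fix x assume "x \<in> arc d p ` params d"
  then obtain s where s: "s \<in> params d" and x: "x = arc d p s" by blast
  have "x \<in> front_curve d" using s x by (auto simp: front_curve_def)
  moreover have "x \<in> window p"
    using s d front_neg [OF d s, of "-1"] front_pos [OF d s, of 1]
    by (auto simp: x arc_def window_def abs_less_iff)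
  ultimately show "x \<in> front_curve d \<inter> window p" by blast
qed

lemma open_window: "open (window p)"
proof -
  have c: "continuous_on UNIV (\<lambda>x :: linf \<times> real. apply_bcontfun (fst x) n)" for n
    by (intro bounded_linear.continuous_on [OF bounded_linear_apply] continuous_intros)
  show ?thesis
    unfolding window_def params_def greaterThanLessThan_iff conj_assoc
    by (intro open_Collect_conj open_Collect_less c continuous_intros)
qed

lemma chart:
  fixes p :: int
  obtains g h where "smooth_on UNIV g" "\<And>t. vector_derivative g (at t) \<noteq> 0"
    "homeomorphism UNIV (arc d p ` params d) g h"
proof -
  \<comment> \<open>A chart must be defined on the whole line, so \<open>params d\<close>, of length
    1 - 3d, is covered by a rescaled arctangent, which extends holomorphically to |Im z| <
    1.\<close>
  define w where "w = (1 - 3 * d) / pi"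
  have w: "w > 0" "w * pi = 1 - 3 * d" using d by (auto simp: w_def)
  define \<sigma> where "\<sigma> t = 1 / 2 + w * arctan t" for t
  define \<rho> where "\<rho> s = tan ((s - 1 / 2) / w)" for s
  have \<sigma>_dom: "\<sigma> t \<in> params d" for t
  proof -
    have "w * arctan t < w * (pi / 2)" "w * (- (pi / 2)) < w * arctan t"
      using w(1) arctan_bounded [of t] by (intro mult_strict_left_mono; simp)+
    moreover have "w * (pi / 2) = (1 - 3 * d) / 2" using w(2) by simp
    ultimately show ?thesis
      unfolding \<sigma>_def params_def greaterThanLessThan_iff by (simp add: algebra_simps)
  qed
  have \<rho>_range: "- (pi / 2) < (s - 1 / 2) / w" "(s - 1 / 2) / w < pi / 2" if "s \<in> params d" for s
    using that w d by (auto simp: params_def field_simps)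
  have \<rho>\<sigma>: "\<rho> (\<sigma> t) = t" for t
    using w(1) by (simp add: \<rho>_def \<sigma>_def tan_arctan)
  have \<sigma>\<rho>: "\<sigma> (\<rho> s) = s" if "s \<in> params d" for s
    using \<rho>_range [OF that] w(1) by (simp add: \<rho>_def \<sigma>_def arctan_tan)
  let ?g = "\<lambda>t. arc d p (\<sigma> t)" and ?h = "\<lambda>x :: linf \<times> real. \<rho> (apply_bcontfun (fst x) (- p))"
  have coord: "apply_bcontfun (fst (arc d p s)) (- p) = s" if "s \<in> params d" for s
    using that d by (simp add: arc_def)
  have blin: "bounded_linear (\<lambda>x :: linf \<times> real. apply_bcontfun (fst x) (- p))"
    by (rule bounded_linear_compose [OF bounded_linear_apply bounded_linear_fst])
  have smooth: "smooth_on UNIV ?g"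
  proof (rule smooth_on_arc [of "\<lambda>z. 1 / 2 + of_real w * Arctan z" "{z. \<bar>Im z\<bar> < 1}"])
    show "(\<lambda>z. 1 / 2 + of_real w * Arctan z) holomorphic_on {z. \<bar>Im z\<bar> < 1}"
      by (intro holomorphic_intros holomorphic_on_Arctan) auto
    show "open {z. \<bar>Im z\<bar> < 1}"
      by (intro open_Collect_less continuous_intros)
  qed (use \<sigma>_dom [unfolded \<sigma>_def] in \<open>auto simp: \<sigma>_def Arctan_of_real\<close>)
  show thesis
  proof (rule that [OF smooth])
    fix t
    show "vector_derivative ?g (at t) \<noteq> 0"
    proof
      assume "vector_derivative ?g (at t) = 0"
      then have "(?g has_vector_derivative 0) (at t)"
        using smooth_on_UNIV_imp_differentiable [OF smooth, of t] vector_derivative_works by metis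
      \<comment> \<open>Coordinate -p of the curve is the parameter itself, so a vanishing velocity
        would force the derivative of \<open>\<sigma>\<close> to vanish.\<close>
      from bounded_linear.has_vector_derivative [OF blin this]
      have "(\<sigma> has_vector_derivative 0) (at t)"
        by (simp add: coord \<sigma>_dom)
      moreover have "(\<sigma> has_vector_derivative w * inverse (1 + t\<^sup>2)) (at t)"
        unfolding \<sigma>_def has_real_derivative_iff_has_vector_derivative [symmetric]
        by (auto intro!: derivative_eq_intros)
      ultimately have "w * inverse (1 + t\<^sup>2) = 0"
        by (metis vector_derivative_at)
      moreover have "1 + t\<^sup>2 \<noteq> 0" by (metis add_pos_nonneg less_irrefl zero_le_power2 zero_less_one)
      ultimately show False using w(1) by simp
    qed
    show "homeomorphism UNIV (arc d p ` params d) ?g ?h"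
    proof (rule homeomorphismI)
      show "continuous_on UNIV ?g" by (rule smooth_on_imp_continuous_on [OF smooth])
      show "continuous_on (arc d p ` params d) ?h"
      proof (rule continuous_on_compose2 [where g = \<rho> and t = "params d"])
        have "cos ((s - 1 / 2) / w) \<noteq> 0" if "s \<in> params d" for s
          using cos_gt_zero_pi [OF \<rho>_range [OF that]] by simp
        then show "continuous_on (params d) \<rho>"
          unfolding \<rho>_def by (intro continuous_intros ballI) (use w(1) in auto)
        show "continuous_on (arc d p ` params d) (\<lambda>x. apply_bcontfun (fst x) (- p))"
          by (intro bounded_linear.continuous_on [OF blin] continuous_intros)
      qed (auto simp: coord)
      show "?g ` UNIV \<subseteq> arc d p ` params d" using \<sigma>_dom by auto
      show "?h (?g t) = t" for t by (simp add: coord \<sigma>_dom \<rho>\<sigma>)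
      show "?g (?h y) = y" if "y \<in> arc d p ` params d" for y
        using that by (auto simp: coord \<sigma>\<rho>)
    qed auto
  qed
qed

lemma smooth_curve_front_curve: "smooth_curve (front_curve d)"
  unfolding smooth_curve_def
proof (intro conjI ballI)
  show "front_curve d \<noteq> {}" using left_end_params by (auto simp: front_curve_def)
  show "connected (front_curve d)" by (rule connected_front_curve)
  fix x assume "x \<in> front_curve d"
  then obtain p where p: "x \<in> arc d p ` params d" by (auto simp: front_curve_def)
  obtain g h where "smooth_on UNIV g" "\<And>t. vector_derivative g (at t) \<noteq> 0"
    "homeomorphism UNIV (arc d p ` params d) g h" using chart by blast
  then show "\<exists>W g h. open W \<and> x \<in> W \<and> smooth_on UNIV g \<and>
      (\<forall>t. vector_derivative g (at t) \<noteq> 0) \<and> homeomorphism UNIV (front_curve d \<inter> W) g h"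
    using open_window [of p] chart_image [of p] p
    by (intro exI [of _ "window p"] exI [of _ g] exI [of _ h]) auto
qed

lemma front_curve_steady:
  assumes "(U, \<mu>) \<in> front_curve d"
  shows "nagumo_steady d U \<mu>" "(apply_bcontfun U \<longlongrightarrow> 0) at_bot" "(apply_bcontfun U \<longlongrightarrow> 1) at_top" "\<mu> \<in> {0<..<1}"
proof -
  obtain p s where s: "s \<in> params d" and U: "U = shift p (front d s)" and \<mu>: "\<mu> = mu d s"
    using assms by (auto simp: front_curve_def arc_def)
  show "nagumo_steady d U \<mu>"
    unfolding U \<mu> by (intro nagumo_steady_shift front_steady d s)
  have Ueq: "apply_bcontfun U = (\<lambda>n. front d s (n + p))" by (auto simp: U)
  have "filterlim (\<lambda>n. n + p) at_bot at_bot"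
    unfolding filterlim_at_bot eventually_at_bot_linorder
  proof
    fix Z show "\<exists>N. \<forall>n\<le>N. n + p \<le> Z"
      by (intro exI [of _ "Z - p"]) auto
  qed
  from filterlim_compose [OF front_limits(1) [OF d s] this]
  show "(apply_bcontfun U \<longlongrightarrow> 0) at_bot" by (simp add: Ueq)
  have "filterlim (\<lambda>n. n + p) at_top at_top"
    unfolding filterlim_at_top eventually_at_top_linorder
  proof
    fix Z show "\<exists>N. \<forall>n\<ge>N. Z \<le> n + p"
      by (intro exI [of _ "Z - p"]) auto
  qed
  from filterlim_compose [OF front_limits(2) [OF d s] this]
  show "(apply_bcontfun U \<longlongrightarrow> 1) at_top" by (simp add: Ueq)
  show "\<mu> \<in> {0<..<1}" using mu_bounds [OF d s] by (simp add: \<mu>)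
qed

subsection \<open>Convergence to the singular limit\<close>

lemma apply_Ubar [simp]: "apply_bcontfun (Ubar \<mu>) n = (if n \<le> 0 then 0 else 1)"
  by (simp add: Ubar.rep_eq)

lemma apply_Vbar [simp]: "apply_bcontfun (Vbar \<mu>) n = (if n < 0 then 0 else if n = 0 then \<mu> else 1)"
  by (simp add: Vbar.rep_eq)

lemma dist_front_le:
  fixes V :: linf
  assumes s: "s \<in> params d" and V: "\<And>n. n < 0 \<Longrightarrow> V n = 0" "\<And>n. n > 0 \<Longrightarrow> V n = 1" "\<bar>s - V 0\<bar> \<le> e"
    and e: "12 * d \<le> e"
  shows "dist (front d s) V \<le> e"
proof (rule dist_bound)
  fix n
  show "dist (front d s n) (V n) \<le> e"
    using V e s d front_neg [OF d s, of n] front_pos [OF d s, of n]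
    by (cases n "0 :: int" rule: linorder_cases) (auto simp: dist_real_def)
qed

lemma sqrt_facts:
  obtains r where "sqrt d = r" "0 < r" "r < 1 / 1000" "r * r = d" "12 * d \<le> r" "50 * d \<le> r" "d < r"
proof -
  let ?r = "sqrt d"
  have r: "0 < ?r" "d = ?r * ?r" using d by auto
  have "sqrt d < sqrt ((1 / 1000)\<^sup>2)"
    using d by (intro real_sqrt_less_mono) (simp add: power2_eq_square)
  then have r1: "?r < 1 / 1000" by simp
  have "?r * ?r \<le> ?r * (1 / 1000)" using r r1 by (intro mult_left_mono) auto
  then have "1000 * d \<le> ?r" using r by simp
  then show ?thesis using r r1 d by (intro that [of ?r]) auto
qed

text \<open>The cut at sqrt d balances s against d/s. Between the cuts \<mu> = s + O(sqrt d), which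
  is the branch \<open>Vbar\<close>; outside them U_0 is within sqrt d of 0 or 1, which is the
  branch \<open>Ubar\<close>.\<close>

lemma mu_middle:
  assumes "sqrt d = r" "r \<le> s" "s \<le> 1 - r"
  shows "s \<in> params d" "\<bar>mu d s - s\<bar> \<le> 2 * r"
proof -
  have r: "0 < r" "r < 1 / 1000" "r * r = d" "12 * d \<le> r" "50 * d \<le> r" "d < r"
    using sqrt_facts assms(1) by metis+
  show params: "s \<in> params d" using assms(2,3) r d unfolding params_def by auto
  have "r * r \<le> r * s" "r * r \<le> r * (1 - s)"
    using assms r by (intro mult_left_mono; simp)+
  then have "d / s \<le> r" "d / (1 - s) \<le> r"
    using assms(2,3) r by (auto simp: pos_divide_le_eq)
  moreover have "0 \<le> d / s" "0 \<le> d / (1 - s)" using assms(2,3) r d by auto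
  ultimately show "\<bar>mu d s - s\<bar> \<le> 2 * r"
    using mu_near_lead_mu [OF d params] r(5) unfolding lead_mu_def by linarith
qed

lemma arc_near_Gamma0:
  assumes "s \<in> params d"
  shows "\<exists>y\<in>Gamma0. dist (arc d p s) y \<le> 2 * sqrt d"
proof -
  obtain r where r: "sqrt d = r" "0 < r" "r < 1 / 1000" "r * r = d" "12 * d \<le> r" "50 * d \<le> r" "d < r"
    by (rule sqrt_facts)
  let ?\<mu> = "mu d s"
  have \<mu>: "?\<mu> \<in> {0..1}" using mu_bounds [OF d assms] by auto
  have s: "0 < s" "s < 1" using assms d by (auto simp: params_def)
  have near: "dist (arc d p s) (shift q V, ?\<mu>) \<le> 2 * sqrt d"
    if "dist (front d s) (shift (q - p) V) \<le> 2 * r" for q V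
  proof -
    have "shift q V = shift p (shift (q - p) V)" by (simp flip: shift_add)
    then show ?thesis using that r by (simp add: arc_def dist_Pair_Pair)
  qed
  consider "s < r" | "r \<le> s" "s \<le> 1 - r" | "1 - r < s" by linarith
  then show ?thesis
  proof cases
    case 1
    have "dist (arc d p s) (shift p (Ubar ?\<mu>), ?\<mu>) \<le> 2 * sqrt d"
      by (rule near, rule dist_front_le [OF assms]) (use 1 s r in auto)
    then show ?thesis using \<mu> unfolding Gamma0_def by blast
  next
    case 2
    have "dist (arc d p s) (shift p (Vbar ?\<mu>), ?\<mu>) \<le> 2 * sqrt d"
      by (rule near, rule dist_front_le [OF assms])
        (use mu_middle(2) [OF r(1) 2] r in \<open>auto simp: abs_minus_commute\<close>)
    then show ?thesis using \<mu> unfolding Gamma0_def by blast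
  next
    case 3
    \<comment> \<open>With U_0 near 1 the jump lies between sites -1 and 0, one site further left
      than in \<open>Ubar\<close>.\<close>
    have "dist (arc d p s) (shift (p + 1) (Ubar ?\<mu>), ?\<mu>) \<le> 2 * sqrt d"
      by (rule near, rule dist_front_le [OF assms]) (use 3 s r in auto)
    then show ?thesis using \<mu> unfolding Gamma0_def by blast
  qed
qed

lemma arc_in_front_curve: "s \<in> params d \<Longrightarrow> arc d p s \<in> front_curve d"
  by (auto simp: front_curve_def)

lemma dist_arc_le:
  assumes "dist (front d s) (shift (q - p) V) \<le> a" "\<bar>mu d s - \<mu>\<bar> \<le> b" "a + b \<le> c"
  shows "dist (arc d p s) (shift q V, \<mu>) \<le> c"
proof -
  have "shift q V = shift p (shift (q - p) V)" by (simp flip: shift_add)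
  then have "dist (arc d p s) (shift q V, \<mu>) = sqrt ((dist (front d s) (shift (q - p) V))\<^sup>2 + (dist (mu d s) \<mu>)\<^sup>2)"
    by (simp add: arc_def dist_Pair_Pair)
  also have "\<dots> \<le> dist (front d s) (shift (q - p) V) + dist (mu d s) \<mu>"
    by (rule sqrt_sum_squares_le_sum) auto
  finally show ?thesis using assms by (simp add: dist_real_def)
qed

lemma Vbar_near_arc:
  assumes "\<mu> \<in> {0..1}"
  shows "\<exists>x\<in>front_curve d. dist x (shift p (Vbar \<mu>), \<mu>) \<le> 5 * sqrt d"
proof -
  obtain r where r: "sqrt d = r" "0 < r" "r < 1 / 1000" "r * r = d" "12 * d \<le> r" "50 * d \<le> r" "d < r"
    by (rule sqrt_facts)
  \<comment> \<open>On this branch \<mu> is close to s, so \<mu> itself is used, moved into the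
    middle range at a cost of at most r.\<close>
  define s where "s = max r (min \<mu> (1 - r))"
  have s: "r \<le> s" "s \<le> 1 - r" "\<bar>s - \<mu>\<bar> \<le> r" using assms r(2,3) by (auto simp: s_def max_def min_def)
  note m = mu_middle [OF r(1) s(1,2)]
  have "dist (arc d p s) (shift p (Vbar \<mu>), \<mu>) \<le> 5 * sqrt d"
  proof (rule dist_arc_le)
    show "dist (front d s) (shift (p - p) (Vbar \<mu>)) \<le> r"
      by (rule dist_front_le [OF m(1)]) (use s r in auto)
    show "\<bar>mu d s - \<mu>\<bar> \<le> 3 * r" using m(2) s(3) by linarith
  qed (use r in auto)
  then show ?thesis using arc_in_front_curve [OF m(1)] by blast
qed

text \<open>An approximate preimage suffices. For small s the term d/s dominates, which suggests s =
  d/\<mu>; if \<mu> < sqrt d this would exceed sqrt d, and s = sqrt d is taken instead. The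
  assumption \<mu> \<le> 1/2 gives s \<ge> 2d, hence membership in \<open>params d\<close>.\<close>

lemma lead_mu_inverse:
  assumes "0 \<le> \<mu>" "\<mu> \<le> 1 / 2" and r: "sqrt d = r"
  obtains s where "s \<in> params d" "0 < s" "s \<le> r" "\<bar>lead_mu d s - \<mu>\<bar> \<le> 3 * r"
proof -
  have rr: "0 < r" "r < 1 / 1000" "r * r = d" "12 * d \<le> r"
    using sqrt_facts r by metis+
  define s where "s = (if \<mu> < r then r else d / \<mu>)"
  have s: "2 * d \<le> s \<and> s \<le> r \<and> 0 \<le> d / s \<and> \<bar>d / s - \<mu>\<bar> \<le> r"
  proof (cases "\<mu> < r")
    case True
    have "d / r = r" using rr by (simp add: divide_eq_eq)
    then show ?thesis using True assms(1) rr by (auto simp: s_def)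
  next
    case False
    have "r * r \<le> r * \<mu>" using False rr by (intro mult_left_mono) auto
    then have "d / \<mu> \<le> r" using False rr by (simp add: pos_divide_le_eq)
    moreover have "d * (2 * \<mu>) \<le> d * 1" using assms d by (intro mult_left_mono) auto
    then have "2 * d \<le> d / \<mu>" using False rr by (simp add: pos_le_divide_eq)
    moreover have "d / (d / \<mu>) = \<mu>" using d by simp
    ultimately show ?thesis using False rr by (auto simp: s_def)
  qed
  have "d * (1 / (1 - s)) \<le> d * 2"
    using d s rr by (intro mult_left_mono) (auto simp: field_simps)
  then have "d / (1 - s) \<le> d * 2" by simp
  moreover have "0 \<le> d / (1 - s)" using d s rr by simp
  ultimately have "\<bar>lead_mu d s - \<mu>\<bar> \<le> 3 * r"
    using s rr d unfolding lead_mu_def by linarith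
  moreover have "s \<in> params d" using s rr d unfolding params_def by auto
  ultimately show ?thesis using s d by (intro that [of s]) auto
qed

lemma Ubar_near_arc:
  assumes "\<mu> \<in> {0..1}"
  shows "\<exists>x\<in>front_curve d. dist x (shift p (Ubar \<mu>), \<mu>) \<le> 5 * sqrt d"
proof -
  obtain r where r: "sqrt d = r" "0 < r" "r < 1 / 1000" "r * r = d" "12 * d \<le> r" "50 * d \<le> r" "d < r"
    by (rule sqrt_facts)
  show ?thesis
  proof (cases "\<mu> \<le> 1 / 2")
    case True
    obtain s where s: "s \<in> params d" "0 < s" "s \<le> r" "\<bar>lead_mu d s - \<mu>\<bar> \<le> 3 * r"
      using lead_mu_inverse [of \<mu> r] True assms r(1) by auto
    have "dist (arc d p s) (shift p (Ubar \<mu>), \<mu>) \<le> 5 * sqrt d"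
    proof (rule dist_arc_le)
      show "dist (front d s) (shift (p - p) (Ubar \<mu>)) \<le> r"
        by (rule dist_front_le [OF s(1)]) (use s r in auto)
      show "\<bar>mu d s - \<mu>\<bar> \<le> 4 * r" using mu_near_lead_mu [OF d s(1)] s(4) r(6) d by linarith
    qed (use r in auto)
    then show ?thesis using arc_in_front_curve [OF s(1)] by blast
  next
    case False
    \<comment> \<open>The part of the arc with U_0 near 0 stops near \<mu> = 2/3, so for larger
      \<mu> the reflected end with U_0 near 1 is used; the translate p - 1 puts the jump at the
      right site.\<close>
    obtain t where t: "t \<in> params d" "0 < t" "t \<le> r" "\<bar>lead_mu d t - (1 - \<mu>)\<bar> \<le> 3 * r"
      using lead_mu_inverse [of "1 - \<mu>" r] False assms r(1) by auto
    define s where "s = 1 - t"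
    have s: "s \<in> params d" "\<bar>lead_mu d s - \<mu>\<bar> \<le> 3 * r" "1 - s \<le> r" "s < 1"
      using params_reflect [OF t(1)] t lead_mu_reflect [of d t] by (auto simp: s_def)
    have "dist (arc d (p - 1) s) (shift p (Ubar \<mu>), \<mu>) \<le> 5 * sqrt d"
    proof (rule dist_arc_le)
      show "dist (front d s) (shift (p - (p - 1)) (Ubar \<mu>)) \<le> r"
        by (rule dist_front_le [OF s(1)]) (use s r in auto)
      show "\<bar>mu d s - \<mu>\<bar> \<le> 4 * r" using mu_near_lead_mu [OF d s(1)] s(2) r(6) d by linarith
    qed (use r in auto)
    then show ?thesis using arc_in_front_curve [OF s(1)] by blast
  qed
qed

lemma hausdorff_dist_front_curve:
  "hausdorff_dist (front_curve d) Gamma0 \<le> ennreal (5 * sqrt d)"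
  unfolding hausdorff_dist_def
proof (rule max.boundedI; rule SUP_least)
  fix x assume "x \<in> front_curve d"
  then obtain p s where s: "s \<in> params d" and x: "x = arc d p s" by (auto simp: front_curve_def)
  obtain y where y: "y \<in> Gamma0" "dist x y \<le> 2 * sqrt d"
    using arc_near_Gamma0 [OF s, of p] x by auto
  have "0 \<le> sqrt d" using d by simp
  then have "ennreal (dist x y) \<le> ennreal (5 * sqrt d)"
    using y(2) by (intro ennreal_leI) linarith
  then show "(INF y\<in>Gamma0. ennreal (dist x y)) \<le> ennreal (5 * sqrt d)"
    by (rule INF_lower2 [OF y(1)])
next
  fix y assume "y \<in> Gamma0"
  then obtain p \<mu> where \<mu>: "\<mu> \<in> {0..1}" and "y = (shift p (Ubar \<mu>), \<mu>) \<or> y = (shift p (Vbar \<mu>), \<mu>)"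
    unfolding Gamma0_def by blast
  then obtain x where x: "x \<in> front_curve d" "dist x y \<le> 5 * sqrt d"
    using Ubar_near_arc [OF \<mu>, of p] Vbar_near_arc [OF \<mu>, of p] by blast
  then have "ennreal (dist x y) \<le> ennreal (5 * sqrt d)"
    by (intro ennreal_leI)
  then show "(INF x\<in>front_curve d. ennreal (dist x y)) \<le> ennreal (5 * sqrt d)"
    by (rule INF_lower2 [OF x(1)])
qed

end

theorem proposition3p1:
  shows "\<exists>dstar>0. \<exists>\<Gamma> :: real \<Rightarrow> (linf \<times> real) set.
    (\<forall>d. 0 < d \<and> d < dstar \<longrightarrow>
       smooth_curve (\<Gamma> d) \<and>
       \<Gamma> d \<subseteq> UNIV \<times> {0<..<1} \<and>
       (\<forall>(U, \<mu>) \<in> \<Gamma> d. nagumo_steady d U \<mu> \<and>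
          (apply_bcontfun U \<longlongrightarrow> 0) at_bot \<and> (apply_bcontfun U \<longlongrightarrow> 1) at_top) \<and>
       closed_loop (shift_proj ` \<Gamma> d)) \<and>
    ((\<lambda>d. hausdorff_dist (\<Gamma> d) Gamma0) \<longlongrightarrow> 0) (at_right 0)"
proof (intro exI [of _ "1 / 10 ^ 6 :: real"] exI [of _ front_curve] conjI allI impI)
  fix d :: real assume "0 < d \<and> d < 1 / 10 ^ 6"
  then have d: "0 < d" "d < 1 / 10 ^ 6" by auto
  show "smooth_curve (front_curve d)" by (rule smooth_curve_front_curve [OF d])
  show "closed_loop (shift_proj ` front_curve d)" by (rule closed_loop_front_curve [OF d])
  show "front_curve d \<subseteq> UNIV \<times> {0<..<1}"
    using front_curve_steady(4) [OF d] by auto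
  show "\<forall>(U, \<mu>) \<in> front_curve d. nagumo_steady d U \<mu> \<and>
      (apply_bcontfun U \<longlongrightarrow> 0) at_bot \<and> (apply_bcontfun U \<longlongrightarrow> 1) at_top"
    using front_curve_steady [OF d] by blast
next
  have "((\<lambda>d. 5 * sqrt d) \<longlongrightarrow> 5 * sqrt 0) (at_right 0)"
    by (intro tendsto_intros)
  then have lim: "((\<lambda>d. ennreal (5 * sqrt d)) \<longlongrightarrow> 0) (at_right 0)"
    using tendsto_ennrealI by fastforce
  have "\<forall>\<^sub>F d in at_right 0. hausdorff_dist (front_curve d) Gamma0 \<le> ennreal (5 * sqrt d)"
    unfolding eventually_at_right_field
    by (intro exI [of _ "1 / 10 ^ 6"]) (auto intro: hausdorff_dist_front_curve)
  then show "((\<lambda>d. hausdorff_dist (front_curve d) Gamma0) \<longlongrightarrow> 0) (at_right 0)"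
    by (intro tendsto_sandwich [OF _ _ tendsto_const lim]) auto
qed simp

end
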